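(* Fix $B,C>0$ and let $B_c=1+\sqrt{1+1/C}$. For $0\le\delta<1$ let $X=X^{(n)}=(X_{ij})$, $n\ge1$, be random matrices defined on a common probability space such that for each $n$ the matrix $X^{(n)}$ is uniformly distributed on $\mathcal{M}_{n,\delta}(B,C)$. If $1/2<\delta<1$, then almost surely $$\lim_{n\to\infty}\frac1n\sum_{k=1}^n X_{1,k+\lfloor n^\delta\rfloor}=\begin{cases}BC&\text{if }B<B_c,\\ B_cC&\text{if }B>B_c.\end{cases}$$ Furthermore, for all $B,C>0$ and $0\le\delta<1$, almost surely $$\lim_{n\to\infty}\frac1n\sum_{k=1}^n X_{n+1,k+\lfloor n^\delta\rfloor}=C.$$
   Context: $\mathbb{N}=\{0,1,2,\dots\}$. For $n\ge1$, $0\le\delta\le1$, $B,C\ge0$, $\mathcal{M}_{n,\delta}(B,C)$ is the set of all square matrices of size $\lfloor n^\delta\rfloor+n$ with entries in $\mathbb{N}$ whose first $\lfloor n^\delta\rfloor$ row sums and column sums equal $\lfloor BCn\rfloor$ and whose last $n$ row sums and column sums equal $\lfloor Cn\rfloor$. Inside the sums and limits, $X$ denotes $X^{(n)}$. *)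

theory Defs
  imports "HOL-Probability.Probability" "Jordan_Normal_Form.Matrix"
begin

definition num_special :: "nat \<Rightarrow> real \<Rightarrow> nat" where
  "num_special n \<delta> = nat \<lfloor>real n powr \<delta>\<rfloor>"

definition margin :: "nat \<Rightarrow> real \<Rightarrow> real \<Rightarrow> real \<Rightarrow> nat \<Rightarrow> nat" where
  "margin n \<delta> B C i =
     (if i < num_special n \<delta> then nat \<lfloor>B * C * real n\<rfloor> else nat \<lfloor>C * real n\<rfloor>)"

text \<open>Matrices are indexed from 0: the mathematical entry with indices \<open>(i, j)\<close>, \<open>i, j \<ge> 1\<close>,
  is \<open>A $$ (i - 1, j - 1)\<close>.\<close>

definition contingency_tables :: "nat \<Rightarrow> real \<Rightarrow> real \<Rightarrow> real \<Rightarrow> nat mat set" where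
  "contingency_tables n \<delta> B C =
     {A \<in> carrier_mat (num_special n \<delta> + n) (num_special n \<delta> + n).
        (\<forall>i < num_special n \<delta> + n. (\<Sum>j < num_special n \<delta> + n. A $$ (i, j)) = margin n \<delta> B C i) \<and>
        (\<forall>j < num_special n \<delta> + n. (\<Sum>i < num_special n \<delta> + n. A $$ (i, j)) = margin n \<delta> B C j)}"

text \<open>For \<open>n \<ge> 1\<close>, \<open>0 \<le> \<delta> \<le> 1\<close> and \<open>B, C \<ge> 0\<close> this set is finite, and it is nonempty because
  it contains the diagonal matrix of the margins; hence \<^const>\<open>pmf_of_set\<close> of it really is
  its uniform distribution.\<close>

definition critical_B :: "real \<Rightarrow> real" where
  "critical_B C = 1 + sqrt (1 + 1 / C)"

end

theory Submission
  imports Defs "HOL-Real_Asymp.Real_Asymp"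
begin

text \<open>The proof is local and elementary: no enumeration of contingency tables enters.  Write \<open>m\<close> for the
number of special lines and \<open>R\<close>, \<open>S\<close> for the special and the ordinary margin.  Two symmetries of the
uniform measure do all the work.

The first is resampling of two rows.  Fix a table outside two rows of equal margin \<open>R\<close> and fix the sum
\<open>c\<close> of these rows.  The first row is then uniform among the \<open>x\<close> with \<open>x j \<le> c j\<close> and
\<open>\<Sum>j. x j = R\<close>, which is the middle level of a box.  The level sizes of a box are symmetric and
unimodal, and this has two consequences.  The middle level contains at least the fraction
\<open>1 / (2 R + 1)\<close> of the box, so Hoeffding's inequality for independent coordinates holds on it up to the
factor \<open>2 R + 1\<close>; this gives \<open>all_pairs_concentration\<close>.  Moreover each coordinate of \<open>x\<close>
has a symmetric unimodal law about \<open>c j / 2\<close>, which does not favour the ends \<open>0\<close> and \<open>c j\<close>: when one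
of the two rows has a large entry in a column, the other tends to have one too.
Since a column has a bounded sum, only few rows can share a large entry, and iterating this gives
\<open>entry_tail\<close>: every entry is at most a constant times \<open>n powr \<eta>\<close> times its typical order, outside an event of
probability \<open>O(n powr -k)\<close> for any prescribed \<open>k\<close>.

With bounded entries, Hoeffding's inequality shows that all rows of one kind put almost the same mass on the
ordinary columns.  For ordinary rows this already determines the limit \<open>C\<close>, as the special columns carry
only \<open>O(n m)\<close> of the mass \<open>C n\<^sup>2\<close>.  For the special rows it remains to find the total mass, written
\<open>u m n\<close>, of the special rows on the ordinary columns.

Hoeffding's inequality, applied to the function \<open>zero_balance\<close>, also shows that each block has the proportion of
positive entries of geometric variables with the mean of the block: a block of mean \<open>u\<close> has the
proportion \<open>u / (1 + u)\<close> (lemma \<open>block_density\<close>).  The second symmetry is the switch that moves one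
unit along a two by two minor with one corner in each of the four blocks.  It changes the mass of the special block by one, and
comparing the numbers of possible switches up and down gives an exact balance between neighbouring values of
that mass (\<open>switching_balance\<close>).  The number of switches in one direction is about
\<open>m\<^sup>2 n\<^sup>2 (u / (1 + u))\<^sup>2\<close>.  In the other direction it is about \<open>m\<^sup>2 n\<^sup>2 C / (1 + C)\<close>, provided that
the special block has a mass of order \<open>n m\<close>, because its \<open>m\<^sup>2\<close> entries are then mostly positive.  The
two agree exactly for \<open>u = critical_B C * C\<close>.  Below and above this value the total mass has a drift towards
it, with geometrically small probabilities away from it (\<open>drift_tail\<close>), unless the margin \<open>B C n\<close> is
exhausted first.  Hence \<open>u\<close> is close to \<open>min (B * C) (critical_B C * C)\<close>.

All exceptional events have summable probabilities, so almost sure convergence follows from the Borel--Cantelli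
lemma whatever the joint law of the matrices.\<close>

section \<open>Level sizes of a box\<close>

text \<open>Vectors are extended by zero outside their index set, so that a row of a table is such a vector without
  any restriction operator.\<close>

definition subvecs :: "'i set \<Rightarrow> ('i \<Rightarrow> nat) \<Rightarrow> ('i \<Rightarrow> nat) set" where
  "subvecs J c = {x. (\<forall>j\<in>J. x j \<le> c j) \<and> (\<forall>j. j \<notin> J \<longrightarrow> x j = 0)}"

definition slice :: "'i set \<Rightarrow> ('i \<Rightarrow> nat) \<Rightarrow> nat \<Rightarrow> ('i \<Rightarrow> nat) set" where
  "slice J c s = {x \<in> subvecs J c. sum x J = s}"

lemma finite_subvecs:
  assumes "finite J"
  shows "finite (subvecs J c)"
proof -
  have "finite {x. \<forall>j. (j \<in> J \<longrightarrow> x j \<in> {..sum c J}) \<and> (j \<notin> J \<longrightarrow> x j = 0)}"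
    using assms by (intro finite_set_of_finite_funs) auto
  moreover have "subvecs J c \<subseteq> {x. \<forall>j. (j \<in> J \<longrightarrow> x j \<in> {..sum c J}) \<and> (j \<notin> J \<longrightarrow> x j = 0)}"
    using assms member_le_sum[of _ J c] by (auto simp: subvecs_def intro: order_trans)
  ultimately show ?thesis by (rule rev_finite_subset)
qed

lemma finite_slice: "finite J \<Longrightarrow> finite (slice J c s)"
  by (rule rev_finite_subset[OF finite_subvecs]) (auto simp: slice_def)

lemma sum_subvecs_insert:
  assumes "finite J" "a \<notin> J"
  shows "(\<Sum>x\<in>subvecs (insert a J) c. G x) = (\<Sum>k\<le>c a. \<Sum>x\<in>subvecs J c. G (x(a := k)))"
proof -
  have "(\<Sum>x\<in>subvecs (insert a J) c. G x) = (\<Sum>(k, x)\<in>{..c a} \<times> subvecs J c. G (x(a := k)))"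
    using assms
    by (intro sum.reindex_bij_witness[where i = "\<lambda>(k, x). x(a := k)" and j = "\<lambda>x. (x a, x(a := 0))"])
       (auto simp: subvecs_def fun_eq_iff)
  then show ?thesis by (simp add: sum.cartesian_product)
qed

text \<open>The level is an integer because the symmetry about half the total size of the box reflects levels, and
  reflected levels may be negative.\<close>

definition level_count :: "'i set \<Rightarrow> ('i \<Rightarrow> nat) \<Rightarrow> int \<Rightarrow> nat" where
  "level_count J c s = card {x \<in> subvecs J c. int (sum x J) = s}"

lemma level_count_eq_sum:
  assumes "finite J"
  shows "level_count J c s = (\<Sum>x\<in>subvecs J c. of_bool (int (sum x J) = s))"
  using finite_subvecs[OF assms] by (simp add: level_count_def sum.If_cases of_bool_def Int_def)

lemma sum_fun_upd_notin: "a \<notin> J \<Longrightarrow> sum (x(a := k)) J = sum x J"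
  by (rule sum.cong) auto

lemma level_count_insert:
  assumes "finite J" "a \<notin> J"
  shows "level_count (insert a J) c s = (\<Sum>k\<le>c a. level_count J c (s - int k))"
proof -
  have *: "(int k + int (sum x J) = s) = (int (sum x J) = s - int k)" for k x by auto
  show ?thesis
    unfolding level_count_eq_sum[OF assms(1)] level_count_eq_sum[OF finite.insertI[OF assms(1)]]
      sum_subvecs_insert[OF assms]
    by (intro sum.cong refl)
      (simp add: assms sum_fun_upd_notin * del: of_nat_sum fun_upd_apply, simp add: * del: of_nat_sum)
qed

text \<open>Symmetry moves both arguments to the left of the centre \<open>M / 2\<close>, where the step inequality makes
  \<open>h\<close> monotone.\<close>

lemma symmetric_unimodalI:
  fixes h :: "int \<Rightarrow> nat"
  assumes sym: "\<And>s. h (M - s) = h s"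
    and step: "\<And>s. 2 * s + 1 \<le> M \<Longrightarrow> h s \<le> h (s + 1)"
    and le: "\<bar>2 * s - M\<bar> \<le> \<bar>2 * t - M\<bar>"
  shows "h t \<le> h s"
proof -
  have mono: "h v \<le> h w" if "v \<le> w" "2 * w \<le> M" for v w
    using that
  proof (induction w rule: int_ge_induct)
    case (step i)
    then have "h v \<le> h i" by simp
    also have "\<dots> \<le> h (i + 1)" using step.prems by (intro assms(2)) auto
    finally show ?case .
  qed simp
  define s' where "s' = (if 2 * s \<le> M then s else M - s)"
  define t' where "t' = (if 2 * t \<le> M then t else M - t)"
  have "h t' \<le> h s'" using le by (intro mono) (auto simp: s'_def t'_def)
  then show ?thesis by (auto simp: s'_def t'_def sym split: if_splits)
qed

text \<open>Moving the window by one adds the term at the right end and drops the one at the left end.\<close>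

lemma sliding_window_sum:
  fixes g :: "int \<Rightarrow> nat"
  shows "(\<Sum>k\<le>c. g (s + 1 - int k)) + g (s - int c) = (\<Sum>k\<le>c. g (s - int k)) + g (s + 1)"
proof (induction c)
  case (Suc c)
  have "s + 1 - int (Suc c) = s - int c" by simp
  then show ?case using Suc by simp
qed simp

text \<open>Adding a coordinate replaces the level sizes by their sums over a sliding window.  A shift of the window
  towards the centre gains a term that is nearer to the centre than the term that it loses, so unimodality
  survives.\<close>

lemma level_count_symmetric_unimodal:
  assumes "finite J" "\<bar>2 * s - int (sum c J)\<bar> \<le> \<bar>2 * t - int (sum c J)\<bar>"
  shows "level_count J c t \<le> level_count J c s"
  using assms
proof (induction J arbitrary: s t rule: finite_induct)
  case empty
  then show ?case by (cases "t = 0") (auto simp: level_count_def)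
next
  case (insert a J)
  let ?g = "level_count J c" and ?h = "level_count (insert a J) c"
  let ?M = "int (sum c J)"
  have g_sym: "?g (?M - s) = ?g s" for s
    by (intro antisym insert.IH) auto
  have h: "?h s = (\<Sum>k\<le>c a. ?g (s - int k))" for s
    by (rule level_count_insert) (use insert in auto)
  have h_sym: "?h (?M + int (c a) - s) = ?h s" for s
  proof -
    have "?h (?M + int (c a) - s) = (\<Sum>k\<le>c a. ?g (?M - (s - int (c a - k))))"
      unfolding h by (intro sum.cong refl arg_cong[where f = ?g]) (auto simp: of_nat_diff)
    also have "\<dots> = (\<Sum>k\<le>c a. ?g (s - int (c a - k)))" by (simp only: g_sym)
    also have "\<dots> = ?h s"
      unfolding h by (rule sum.reindex_bij_witness[where i = "\<lambda>k. c a - k" and j = "\<lambda>k. c a - k"]) auto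
    finally show ?thesis .
  qed
  have h_step: "?h s \<le> ?h (s + 1)" if "2 * s + 1 \<le> ?M + int (c a)" for s
  proof -
    have "?g (s - int (c a)) \<le> ?g (s + 1)" by (rule insert.IH) (use that in auto)
    then show ?thesis using sliding_window_sum[of ?g s "c a"] by (simp add: h)
  qed
  have "int (sum c (insert a J)) = ?M + int (c a)" using insert by simp
  with insert.prems show ?case
    by (intro symmetric_unimodalI[OF h_sym h_step]) auto
qed

lemma card_slice_eq_level_count: "card (slice J c s) = level_count J c (int s)"
  by (simp add: slice_def level_count_def del: of_nat_sum)

text \<open>The box has \<open>2 R + 1\<close> levels and the middle one is the largest.  This is the price of passing
  from independent coordinates to coordinates with a prescribed sum.\<close>

lemma card_subvecs_le_middle_slice:
  assumes "finite J" "sum c J = 2 * R"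
  shows "card (subvecs J c) \<le> (2 * R + 1) * card (slice J c R)"
proof -
  have bd: "sum x J \<le> 2 * R" if "x \<in> subvecs J c" for x
    using that assms(2) sum_mono[of J x c] by (auto simp: subvecs_def)
  have "card (subvecs J c) = card (\<Union>s\<le>2*R. slice J c s)"
    by (rule arg_cong[where f = card]) (use bd in \<open>auto simp: slice_def\<close>)
  also have "\<dots> \<le> (\<Sum>s\<le>2*R. card (slice J c s))" by (rule card_UN_le) simp
  also have "\<dots> \<le> (\<Sum>s\<le>2*R. card (slice J c R))"
    unfolding card_slice_eq_level_count
    by (intro sum_mono level_count_symmetric_unimodal) (use assms in auto)
  finally show ?thesis by simp
qed

text \<open>On the middle level the law of one coordinate is itself symmetric and unimodal, about \<open>c a / 2\<close>.
  When \<open>c a \<ge> 4 b\<close>, the \<open>2 b\<close> values within \<open>b\<close> of the ends weigh at most as much as the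
  at least \<open>2 b + 1\<close> values between them.\<close>

lemma middle_slice_coordinate_spread:
  assumes "finite J" "a \<in> J" "sum c J = 2 * R" "4 * b \<le> c a"
  shows "card (slice J c R) \<le> 2 * card {x \<in> slice J c R. b \<le> x a \<and> b + x a \<le> c a}"
proof -
  define J' where "J' = J - {a}"
  have J: "J = insert a J'" "finite J'" "a \<notin> J'" using assms by (auto simp: J'_def)
  define w where "w k = level_count J' c (int R - int k)" for k
  have M: "int (sum c J') = 2 * int R - int (c a)" using assms(3) J by (simp del: of_nat_sum)
  have w: "w k \<le> w l" if "\<bar>int (c a) - 2 * int l\<bar> \<le> \<bar>int (c a) - 2 * int k\<bar>" for k l
    unfolding w_def
    by (rule level_count_symmetric_unimodal[OF J(2)]) (use that in \<open>simp add: M del: of_nat_sum\<close>)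
  have all: "card (slice J c R) = (\<Sum>k\<le>c a. w k)"
    unfolding card_slice_eq_level_count J(1) level_count_insert[OF J(2,3)] w_def ..
  let ?I = "{b..c a - b}"
  have inner: "card {x \<in> slice J c R. b \<le> x a \<and> b + x a \<le> c a} = (\<Sum>k\<in>?I. w k)"
  proof -
    have "card {x \<in> slice J c R. b \<le> x a \<and> b + x a \<le> c a}
      = (\<Sum>x\<in>subvecs J c. of_bool (int (sum x J) = int R \<and> b \<le> x a \<and> b + x a \<le> c a))"
      using finite_subvecs[OF assms(1), of c]
      by (simp add: slice_def sum.If_cases of_bool_def Int_def conj_assoc del: of_nat_sum)
    also have "\<dots> = (\<Sum>k\<le>c a. \<Sum>x\<in>subvecs J' c.
        of_bool (int (sum x J') = int R - int k) * of_bool (b \<le> k \<and> b + k \<le> c a))"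
      unfolding J(1) sum_subvecs_insert[OF J(2,3)]
      by (intro sum.cong refl) (auto simp: J sum_fun_upd_notin of_bool_def simp del: of_nat_sum fun_upd_apply simp add: fun_upd_same)
    also have "\<dots> = (\<Sum>k\<le>c a. w k * of_bool (b \<le> k \<and> b + k \<le> c a))"
      by (simp add: w_def level_count_eq_sum[OF J(2)] sum_distrib_right)
    also have "\<dots> = (\<Sum>k\<in>?I. w k)"
      by (intro sum.mono_neutral_cong_right) (use assms(4) in auto)
    finally show ?thesis .
  qed
  let ?O = "{..c a} - ?I"
  have "?O = {..<b} \<union> {c a - b <.. c a}" using assms(4) by auto
  then have cO: "card ?O \<le> 2 * b"
    using card_Un_le[of "{..<b}" "{c a - b <.. c a}"] assms(4) by auto
  have "(\<Sum>k\<in>?O. w k) \<le> (\<Sum>k\<in>?O. w b)"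
    by (intro sum_mono w) (use assms(4) in auto)
  also have "\<dots> \<le> 2 * b * w b" using cO by simp
  also have "\<dots> \<le> card ?I * w b" using assms(4) by (intro mult_right_mono) auto
  also have "\<dots> = (\<Sum>k\<in>?I. w b)" by simp
  also have "\<dots> \<le> (\<Sum>k\<in>?I. w k)"
    by (intro sum_mono w) (use assms(4) in auto)
  finally have "(\<Sum>k\<in>?O. w k) \<le> (\<Sum>k\<in>?I. w k)" .
  moreover have "(\<Sum>k\<le>c a. w k) = (\<Sum>k\<in>?O. w k) + (\<Sum>k\<in>?I. w k)"
    by (rule sum.subset_diff) auto
  ultimately show ?thesis unfolding all inner by simp
qed

section \<open>Concentration on the middle level\<close>

text \<open>Hoeffding's lemma for a uniform variable on \<open>{..c}\<close>, in the form that multiplies over the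
  coordinates of a box.\<close>

lemma exponential_moment_le:
  fixes \<phi> :: "nat \<Rightarrow> real"
  assumes "(\<Sum>k\<le>c. \<phi> k) = 0" "\<And>k. k \<le> c \<Longrightarrow> \<bar>\<phi> k\<bar> \<le> L" "l > 0"
  shows "(\<Sum>k\<le>c. exp (l * \<phi> k)) \<le> exp (l\<^sup>2 * L\<^sup>2 / 2) * real (Suc c)"
proof -
  let ?M = "measure_pmf (pmf_of_set {..c})"
  interpret interval_bounded_random_variable ?M \<phi> "-L" L
  proof
    show "AE x in ?M. \<phi> x \<in> {-L..L}"
      by (rule AE_pmfI) (use assms(2) in \<open>fastforce simp: abs_le_iff\<close>)
  qed auto
  have "measure_pmf.expectation (pmf_of_set {..c}) \<phi> = 0"
    by (subst integral_pmf_of_set) (use assms(1) in auto)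
  from Hoeffdings_lemma_nn_integral_0[OF assms(3) this]
  have "ennreal ((\<Sum>k\<le>c. exp (l * \<phi> k)) / real (Suc c)) \<le> ennreal (exp (l\<^sup>2 * L\<^sup>2 / 2))"
    by (subst (asm) nn_integral_pmf_of_set)
      (auto simp: divide_ennreal sum_nonneg power_mult_distrib ennreal_of_nat_eq_real_of_nat mult.commute
        simp del: of_nat_Suc)
  then have "(\<Sum>k\<le>c. exp (l * \<phi> k)) / real (Suc c) \<le> exp (l\<^sup>2 * L\<^sup>2 / 2)" by (simp del: of_nat_Suc)
  then show ?thesis by (simp add: divide_le_eq del: of_nat_Suc)
qed

lemma card_subvecs_insert:
  assumes "finite J" "a \<notin> J"
  shows "card (subvecs (insert a J) c) = Suc (c a) * card (subvecs J c)"
  using sum_subvecs_insert[OF assms, of "\<lambda>_. 1::nat" c] by simp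

lemma exponential_moment_subvecs_le:
  fixes \<phi> :: "'i \<Rightarrow> nat \<Rightarrow> real"
  assumes "finite J" "\<And>j. j \<in> J \<Longrightarrow> (\<Sum>k\<le>c j. \<phi> j k) = 0"
    "\<And>j k. j \<in> J \<Longrightarrow> k \<le> c j \<Longrightarrow> \<bar>\<phi> j k\<bar> \<le> L j" "l > 0"
  shows "(\<Sum>x\<in>subvecs J c. exp (l * (\<Sum>j\<in>J. \<phi> j (x j))))
    \<le> exp (l\<^sup>2 * (\<Sum>j\<in>J. (L j)\<^sup>2) / 2) * card (subvecs J c)"
  using assms
proof (induction J rule: finite_induct)
  case (insert a J)
  have upd: "(\<Sum>j\<in>J. \<phi> j ((x(a := k)) j)) = (\<Sum>j\<in>J. \<phi> j (x j))" for x k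
    by (rule sum.cong) (use insert.hyps in auto)
  have "(\<Sum>x\<in>subvecs (insert a J) c. exp (l * (\<Sum>j\<in>insert a J. \<phi> j (x j))))
    = (\<Sum>k\<le>c a. exp (l * \<phi> a k)) * (\<Sum>x\<in>subvecs J c. exp (l * (\<Sum>j\<in>J. \<phi> j (x j))))"
    unfolding sum_subvecs_insert[OF insert.hyps] sum_product
    by (intro sum.cong refl) (simp add: insert.hyps upd distrib_left exp_add del: fun_upd_apply, simp)
  also have "\<dots> \<le> (exp (l\<^sup>2 * (L a)\<^sup>2 / 2) * real (Suc (c a)))
      * (exp (l\<^sup>2 * (\<Sum>j\<in>J. (L j)\<^sup>2) / 2) * card (subvecs J c))"
    by (intro mult_mono exponential_moment_le insert.IH sum_nonneg mult_nonneg_nonneg)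
      (use insert.prems in auto)
  also have "\<dots> = exp (l\<^sup>2 * (\<Sum>j\<in>insert a J. (L j)\<^sup>2) / 2) * card (subvecs (insert a J) c)"
    by (simp add: insert.hyps card_subvecs_insert distrib_left add_divide_distrib exp_add
        del: of_nat_Suc mult_Suc)
  finally show ?case .
qed (simp add: subvecs_def)

text \<open>Chernoff's bound in the whole box, compared with the middle level instead of the box.\<close>

lemma middle_slice_upper_tail:
  fixes \<phi> :: "'i \<Rightarrow> nat \<Rightarrow> real" and L t :: real
  assumes "finite J" "sum c J = 2 * R" "J0 \<subseteq> J" "J0 \<noteq> {}"
    "\<And>j. j \<in> J0 \<Longrightarrow> (\<Sum>k\<le>c j. \<phi> j k) = 0"
    "\<And>j k. j \<in> J0 \<Longrightarrow> k \<le> c j \<Longrightarrow> \<bar>\<phi> j k\<bar> \<le> L" "L > 0" "t > 0"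
  shows "card {x \<in> slice J c R. t \<le> (\<Sum>j\<in>J0. \<phi> j (x j))}
    \<le> (2 * R + 1) * exp (- (t\<^sup>2 / (2 * L\<^sup>2 * card J0))) * card (slice J c R)"
proof -
  define q where "q = real (card J0)"
  have q: "q > 0" using assms(1,3,4) by (auto simp: q_def card_gt_0_iff dest: finite_subset)
  \<comment> \<open>the value at which the exponent \<open>l\<^sup>2 * L\<^sup>2 * q / 2 - l * t\<close> is smallest\<close>
  define l where "l = t / (L\<^sup>2 * q)"
  have l: "l > 0" using q assms by (simp add: l_def)
  define \<psi> where "\<psi> j = (if j \<in> J0 then \<phi> j else (\<lambda>_. 0))" for j
  have \<psi>: "(\<Sum>j\<in>J. \<psi> j (x j)) = (\<Sum>j\<in>J0. \<phi> j (x j))" for x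
    by (rule sum.mono_neutral_cong_right) (use assms in \<open>auto simp: \<psi>_def\<close>)
  have L2: "(\<Sum>j\<in>J. (if j \<in> J0 then L else 0)\<^sup>2) = L\<^sup>2 * q"
  proof -
    have "(\<Sum>j\<in>J. (if j \<in> J0 then L else 0)\<^sup>2) = (\<Sum>j\<in>J0. L\<^sup>2)"
      by (rule sum.mono_neutral_cong_right) (use assms in auto)
    then show ?thesis by (simp add: q_def)
  qed
  let ?E = "{x \<in> slice J c R. t \<le> (\<Sum>j\<in>J0. \<phi> j (x j))}"
  have sub: "?E \<subseteq> subvecs J c" by (auto simp: slice_def)
  have "exp (l * t) * card ?E = (\<Sum>x\<in>?E. exp (l * t))" by simp
  also have "\<dots> \<le> (\<Sum>x\<in>?E. exp (l * (\<Sum>j\<in>J. \<psi> j (x j))))"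
    by (intro sum_mono) (use l in \<open>simp add: \<psi>\<close>)
  also have "\<dots> \<le> (\<Sum>x\<in>subvecs J c. exp (l * (\<Sum>j\<in>J. \<psi> j (x j))))"
    by (intro sum_mono2 sub finite_subvecs assms) auto
  also have "\<dots> \<le> exp (l\<^sup>2 * (\<Sum>j\<in>J. (if j \<in> J0 then L else 0)\<^sup>2) / 2) * card (subvecs J c)"
    by (intro exponential_moment_subvecs_le) (use assms l in \<open>auto simp: \<psi>_def\<close>)
  also have "\<dots> \<le> exp (l\<^sup>2 * (L\<^sup>2 * q) / 2) * ((2 * R + 1) * card (slice J c R))"
    unfolding L2 using card_subvecs_le_middle_slice[OF assms(1,2)]
    by (intro mult_left_mono) (simp_all del: of_nat_mult of_nat_add add: of_nat_le_iff flip: of_nat_mult)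
  finally have "card ?E \<le> exp (- (l * t)) * (exp (l\<^sup>2 * (L\<^sup>2 * q) / 2) * ((2 * R + 1) * card (slice J c R)))"
    by (simp add: exp_minus field_simps)
  also have "\<dots> = exp (l\<^sup>2 * (L\<^sup>2 * q) / 2 - l * t) * ((2 * R + 1) * card (slice J c R))"
    by (simp only: exp_diff exp_minus) (simp add: field_simps)
  also have "l\<^sup>2 * (L\<^sup>2 * q) / 2 - l * t = - (t\<^sup>2 / (2 * L\<^sup>2 * q))"
    using q assms(7) by (simp add: l_def field_simps power2_eq_square)
  finally show ?thesis by (simp add: q_def algebra_simps)
qed

lemma middle_slice_concentration:
  fixes \<phi> :: "'i \<Rightarrow> nat \<Rightarrow> real" and L t :: real
  assumes "finite J" "sum c J = 2 * R" "J0 \<subseteq> J" "J0 \<noteq> {}"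
    "\<And>j. j \<in> J0 \<Longrightarrow> (\<Sum>k\<le>c j. \<phi> j k) = 0"
    "\<And>j k. j \<in> J0 \<Longrightarrow> k \<le> c j \<Longrightarrow> \<bar>\<phi> j k\<bar> \<le> L" "L > 0" "t > 0"
  shows "card {x \<in> slice J c R. t \<le> \<bar>\<Sum>j\<in>J0. \<phi> j (x j)\<bar>}
    \<le> 2 * (2 * R + 1) * exp (- (t\<^sup>2 / (2 * L\<^sup>2 * card J0))) * card (slice J c R)"
proof -
  let ?E = "\<lambda>\<phi>. {x \<in> slice J c R. t \<le> (\<Sum>j\<in>J0. \<phi> j (x j) :: real)}"
  have "{x \<in> slice J c R. t \<le> \<bar>\<Sum>j\<in>J0. \<phi> j (x j)\<bar>} = ?E \<phi> \<union> ?E (\<lambda>j k. - \<phi> j k)"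
    by (auto simp: sum_negf abs_real_def)
  then have "real (card {x \<in> slice J c R. t \<le> \<bar>\<Sum>j\<in>J0. \<phi> j (x j)\<bar>}) \<le> card (?E \<phi>) + card (?E (\<lambda>j k. - \<phi> j k))"
    using card_Un_le[of "?E \<phi>" "?E (\<lambda>j k. - \<phi> j k)"] by (simp del: of_nat_add flip: of_nat_add)
  then show ?thesis
    using middle_slice_upper_tail[OF assms]
      middle_slice_upper_tail[OF assms(1-4), of "\<lambda>j k. - \<phi> j k" L t] assms(5-8)
    by (simp add: sum_negf algebra_simps)
qed

section \<open>Uniform tables with given margins\<close>

text \<open>Tables vanish outside their frame, so that rows can be exchanged by function update and two tables are
  equal when their entries are.\<close>

definition tables :: "nat \<Rightarrow> (nat \<Rightarrow> nat) \<Rightarrow> (nat \<Rightarrow> nat \<Rightarrow> nat) set" where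
  "tables N r = {X. (\<forall>i j. N \<le> i \<or> N \<le> j \<longrightarrow> X i j = 0) \<and>
     (\<forall>i<N. (\<Sum>j<N. X i j) = r i) \<and> (\<forall>j<N. (\<Sum>i<N. X i j) = r j)}"

lemma tables_entry_le_row: "X \<in> tables N r \<Longrightarrow> i < N \<Longrightarrow> X i j \<le> r i"
  using member_le_sum[of j "{..<N}" "X i"] by (cases "j < N") (auto simp: tables_def)

lemma finite_tables: "finite (tables N r)"
proof -
  define B where "B = {g. \<forall>j. (j \<in> {..<N} \<longrightarrow> g j \<in> {..sum r {..<N}}) \<and> (j \<notin> {..<N} \<longrightarrow> g j = (0::nat))}"
  have "finite B" unfolding B_def by (intro finite_set_of_finite_funs) auto
  then have "finite {X. \<forall>i. (i \<in> {..<N} \<longrightarrow> X i \<in> B) \<and> (i \<notin> {..<N} \<longrightarrow> X i = (\<lambda>_. 0))}"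
    by (intro finite_set_of_finite_funs) auto
  moreover have "X i j \<le> sum r {..<N}" if "X \<in> tables N r" "i < N" for X i j
    using tables_entry_le_row[OF that, of j] member_le_sum[of i "{..<N}" r] that by auto
  then have "tables N r \<subseteq> {X. \<forall>i. (i \<in> {..<N} \<longrightarrow> X i \<in> B) \<and> (i \<notin> {..<N} \<longrightarrow> X i = (\<lambda>_. 0))}"
    by (auto simp: B_def tables_def)
  ultimately show ?thesis by (rule rev_finite_subset)
qed

lemma tables_nonempty: "tables N r \<noteq> {}"
proof -
  have "(\<lambda>i j. if i = j \<and> i < N then r i else 0) \<in> tables N r"
    by (auto simp: tables_def sum.If_cases if_distrib cong: if_cong)
  then show ?thesis by blast
qed

definition table_prob :: "nat \<Rightarrow> (nat \<Rightarrow> nat) \<Rightarrow> ((nat \<Rightarrow> nat \<Rightarrow> nat) \<Rightarrow> bool) \<Rightarrow> real" where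
  "table_prob N r Q = measure_pmf.prob (pmf_of_set (tables N r)) {X. Q X}"

lemma card_tables_pos: "card (tables N r) > 0"
  using finite_tables tables_nonempty by (simp add: card_gt_0_iff)

lemma table_prob_eq_card:
  "table_prob N r Q = card {X \<in> tables N r. Q X} / card (tables N r)"
  unfolding table_prob_def
  by (simp add: measure_pmf_of_set[OF tables_nonempty finite_tables] Int_def)

lemma table_prob_eq_sum:
  "table_prob N r Q = (\<Sum>X\<in>tables N r. of_bool (Q X)) / card (tables N r)"
  unfolding table_prob_eq_card using finite_tables[of N r]
  by (simp add: sum.If_cases of_bool_def Int_def)

lemma table_prob_nonneg: "table_prob N r Q \<ge> 0"
  by (simp add: table_prob_def)

lemma table_prob_le_1: "table_prob N r Q \<le> 1"
  by (simp add: table_prob_def)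

lemma table_prob_mono:
  assumes "\<And>X. X \<in> tables N r \<Longrightarrow> Q X \<Longrightarrow> Q' X"
  shows "table_prob N r Q \<le> table_prob N r Q'"
  unfolding table_prob_eq_card
  by (intro divide_right_mono of_nat_mono card_mono) (use assms finite_tables in auto)

lemma table_prob_disj: "table_prob N r (\<lambda>X. Q X \<or> Q' X) \<le> table_prob N r Q + table_prob N r Q'"
proof -
  have "{X. Q X \<or> Q' X} = {X. Q X} \<union> {X. Q' X}" by auto
  then show ?thesis unfolding table_prob_def
    by (simp add: measure_Un_le)
qed

lemma table_prob_bex:
  fixes e :: real
  assumes "finite A" "\<And>a. a \<in> A \<Longrightarrow> table_prob N r (Q a) \<le> e"
  shows "table_prob N r (\<lambda>X. \<exists>a\<in>A. Q a X) \<le> card A * e"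
proof -
  have "{X. \<exists>a\<in>A. Q a X} = (\<Union>a\<in>A. {X. Q a X})" by auto
  then have "table_prob N r (\<lambda>X. \<exists>a\<in>A. Q a X) \<le> (\<Sum>a\<in>A. table_prob N r (Q a))"
    unfolding table_prob_def by (simp add: measure_pmf.finite_measure_subadditive_finite assms(1))
  also have "\<dots> \<le> (\<Sum>a\<in>A. e)" by (intro sum_mono assms)
  finally show ?thesis by simp
qed

text \<open>The margins of rows and columns coincide, so transposition preserves the uniform measure.  It turns every
  statement about rows into one about columns.\<close>

definition flip :: "(nat \<Rightarrow> nat \<Rightarrow> nat) \<Rightarrow> nat \<Rightarrow> nat \<Rightarrow> nat" where
  "flip X = (\<lambda>i j. X j i)"

lemma flip_in_tables: "X \<in> tables N r \<Longrightarrow> flip X \<in> tables N r"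
  by (auto simp: tables_def flip_def)

lemma table_prob_flip: "table_prob N r (\<lambda>X. Q (flip X)) = table_prob N r Q"
proof -
  have "(\<Sum>X\<in>tables N r. of_bool (Q (flip X)) :: real) = (\<Sum>X\<in>tables N r. of_bool (Q X))"
    by (rule sum.reindex_bij_witness[where i = flip and j = flip])
      (simp_all add: flip_in_tables, simp_all add: flip_def)
  then show ?thesis by (simp add: table_prob_eq_sum)
qed

lemma sum_split_two:
  fixes f :: "nat \<Rightarrow> nat"
  assumes "i < N" "k < N" "i \<noteq> k"
  shows "(\<Sum>l<N. f l) = f i + f k + (\<Sum>l\<in>{..<N} - {i, k}. f l)"
proof -
  have "{..<N} = insert i (insert k ({..<N} - {i, k}))" using assms by auto
  then have "(\<Sum>l<N. f l) = (\<Sum>l\<in>insert i (insert k ({..<N} - {i, k})). f l)" by simp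
  also have "\<dots> = f i + f k + (\<Sum>l\<in>{..<N} - {i, k}. f l)" using assms by simp
  finally show ?thesis .
qed

section \<open>Resampling two rows\<close>

text \<open>The tables that agree outside the rows \<open>i\<close> and \<open>k\<close> and in the sum \<open>c\<close> of these two rows are in
  bijection with a middle level: row \<open>i\<close> may be any \<open>x\<close> below \<open>c\<close> with the right sum, and row
  \<open>k\<close> is \<open>c - x\<close>.  An inequality that holds on every middle level therefore holds on average over
  all tables.\<close>

lemma resampling_two_rows:
  fixes \<Phi> \<Psi> :: "(nat \<Rightarrow> nat) \<Rightarrow> (nat \<Rightarrow> nat) \<Rightarrow> real"
  assumes ik: "i < N" "k < N" "i \<noteq> k" and R: "r i = R" "r k = R"
    and le: "\<And>c. sum c {..<N} = 2 * R \<Longrightarrow>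
      (\<Sum>x\<in>slice {..<N} c R. \<Phi> x (\<lambda>j. c j - x j)) \<le> (\<Sum>x\<in>slice {..<N} c R. \<Psi> x (\<lambda>j. c j - x j))"
  shows "(\<Sum>X\<in>tables N r. \<Phi> (X i) (X k)) \<le> (\<Sum>X\<in>tables N r. \<Psi> (X i) (X k))"
proof -
  \<comment> \<open>row \<open>i\<close> of the key is the sum of the two rows, so the key remembers all that resampling keeps\<close>
  define key where "key X = X(i := (\<lambda>j. X i j + X k j), k := (\<lambda>_. 0 :: nat))" for X :: "nat \<Rightarrow> nat \<Rightarrow> nat"
  define T where "T = key ` tables N r"
  have fibre: "(\<Sum>X | X \<in> tables N r \<and> key X = K. F (X i) (X k))
      = (\<Sum>x\<in>slice {..<N} (K i) R. F x (\<lambda>j. K i j - x j))"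
    and total: "sum (K i) {..<N} = 2 * R"
    if K: "K \<in> T" for K and F :: "(nat \<Rightarrow> nat) \<Rightarrow> (nat \<Rightarrow> nat) \<Rightarrow> real"
  proof -
    obtain X0 where X0: "X0 \<in> tables N r" "key X0 = K" using K by (auto simp: T_def)
    define put where "put x = K(i := x, k := (\<lambda>j. K i j - x j))" for x
    have Ki: "K i = (\<lambda>j. X0 i j + X0 k j)" using ik by (simp add: X0(2)[symmetric] key_def)
    have Kl: "K l = X0 l" if "l \<noteq> i" "l \<noteq> k" for l
      using X0(2) that by (auto simp: key_def)
    have Kk: "K k = (\<lambda>_. 0)" using X0(2) by (auto simp: key_def)
    show tot: "sum (K i) {..<N} = 2 * R"
      using X0(1) ik R by (simp add: Ki sum.distrib tables_def)
    have key_put: "key (put x) = K" if "x \<in> slice {..<N} (K i) R" for x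
    proof -
      have "x j \<le> K i j" for j
        using that by (cases "j < N") (auto simp: slice_def subvecs_def)
      then show ?thesis using ik Kk by (auto simp: key_def put_def fun_eq_iff)
    qed
    have put_in: "put x \<in> tables N r" if x: "x \<in> slice {..<N} (K i) R" for x
    proof -
      have le: "x j \<le> K i j" for j
        using x by (cases "j < N") (auto simp: slice_def subvecs_def)
      have s: "sum x {..<N} = R" using x by (simp add: slice_def)
      have "sum (\<lambda>j. K i j - x j) {..<N} = R"
        using sum_subtractf_nat[of "{..<N}" x "K i"] le tot s by simp
      then have rows: "sum (put x l) {..<N} = r l" if "l < N" for l
        using s R X0(1) that ik by (cases "l = i"; cases "l = k") (auto simp: put_def Kl tables_def)
      have cols: "(\<Sum>l<N. put x l j) = r j" if "j < N" for j
      proof -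
        have "(\<Sum>l<N. put x l j) = x j + (K i j - x j) + (\<Sum>l\<in>{..<N} - {i, k}. X0 l j)"
          unfolding sum_split_two[OF ik] using ik
          by (intro arg_cong2[where f = "(+)"] sum.cong) (auto simp: put_def Kl)
        also have "\<dots> = (\<Sum>l<N. X0 l j)"
          unfolding sum_split_two[OF ik] using le[of j] by (simp add: Ki)
        finally show ?thesis using X0(1) that by (simp add: tables_def)
      qed
      have "put x l j = 0" if "N \<le> l \<or> N \<le> j" for l j
        using that X0(1) x ik
        by (cases "l = i"; cases "l = k") (auto simp: put_def Kl Ki tables_def slice_def subvecs_def)
      with rows cols show ?thesis by (simp add: tables_def)
    qed
    have get: "X i \<in> slice {..<N} (K i) R" "put (X i) = X" "X k = (\<lambda>j. K i j - X i j)"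
      if "X \<in> tables N r" "key X = K" for X
    proof -
      have XK: "K i = (\<lambda>j. X i j + X k j)" using ik by (simp add: that(2)[symmetric] key_def)
      show "X i \<in> slice {..<N} (K i) R"
        using that ik R unfolding XK by (auto simp: slice_def subvecs_def tables_def)
      show "X k = (\<lambda>j. K i j - X i j)" by (simp add: XK)
      show "put (X i) = X"
      proof
        fix l
        show "put (X i) l = X l"
          using that(2) XK by (cases "l = i"; cases "l = k") (auto simp: put_def key_def)
      qed
    qed
    show "(\<Sum>X | X \<in> tables N r \<and> key X = K. F (X i) (X k))
      = (\<Sum>x\<in>slice {..<N} (K i) R. F x (\<lambda>j. K i j - x j))"
      by (rule sum.reindex_bij_witness[where i = put and j = "\<lambda>X. X i"])
        (use get key_put put_in ik in \<open>auto simp: put_def\<close>)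
  qed
  have group: "(\<Sum>X\<in>tables N r. F (X i) (X k)) = (\<Sum>K\<in>T. \<Sum>X | X \<in> tables N r \<and> key X = K. F (X i) (X k))"
    for F :: "(nat \<Rightarrow> nat) \<Rightarrow> (nat \<Rightarrow> nat) \<Rightarrow> real"
    by (rule sum.group[symmetric]) (auto simp: T_def finite_tables)
  show ?thesis
    unfolding group
  proof (rule sum_mono)
    fix K assume K: "K \<in> T"
    show "(\<Sum>X | X \<in> tables N r \<and> key X = K. \<Phi> (X i) (X k))
      \<le> (\<Sum>X | X \<in> tables N r \<and> key X = K. \<Psi> (X i) (X k))"
      unfolding fibre[OF K] by (rule le[OF total[OF K]])
  qed
qed

section \<open>Tails of single entries\<close>

text \<open>If one of the two entries is at least \<open>4 * b\<close>, so is their sum, and after resampling both entries are at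
  least \<open>b\<close> with conditional probability at least one half.\<close>

lemma large_entry_spreads:
  assumes "i < N" "k < N" "i \<noteq> k" "r i = r k" "j < N"
  shows "table_prob N r (\<lambda>X. 4 * b \<le> X i j) \<le> 2 * table_prob N r (\<lambda>X. b \<le> X i j \<and> b \<le> X k j)"
proof -
  define \<Phi> :: "(nat \<Rightarrow> nat) \<Rightarrow> (nat \<Rightarrow> nat) \<Rightarrow> real" where "\<Phi> x y = of_bool (4 * b \<le> x j)" for x y
  define \<Psi> :: "(nat \<Rightarrow> nat) \<Rightarrow> (nat \<Rightarrow> nat) \<Rightarrow> real" where "\<Psi> x y = 2 * of_bool (b \<le> x j \<and> b \<le> y j)" for x y
  have "(\<Sum>X\<in>tables N r. \<Phi> (X i) (X k)) \<le> (\<Sum>X\<in>tables N r. \<Psi> (X i) (X k))"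
  proof (rule resampling_two_rows[where R = "r k"])
    fix c :: "nat \<Rightarrow> nat" assume c: "sum c {..<N} = 2 * r k"
    let ?S = "slice {..<N} c (r k)"
    have fin: "finite ?S" by (rule finite_slice) simp
    have xc: "x j \<le> c j" if "x \<in> ?S" for x using that assms(5) by (auto simp: slice_def subvecs_def)
    show "(\<Sum>x\<in>?S. \<Phi> x (\<lambda>j. c j - x j)) \<le> (\<Sum>x\<in>?S. \<Psi> x (\<lambda>j. c j - x j))"
    proof (cases "4 * b \<le> c j")
      case True
      have "(\<Sum>x\<in>?S. \<Phi> x (\<lambda>j. c j - x j)) \<le> (\<Sum>x\<in>?S. 1)"
        by (intro sum_mono) (simp add: \<Phi>_def)
      also have "\<dots> \<le> real (2 * card {x \<in> ?S. b \<le> x j \<and> b + x j \<le> c j})"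
        using middle_slice_coordinate_spread[OF _ _ c True] assms(5) by (simp flip: of_nat_le_iff)
      also have "\<dots> = (\<Sum>x\<in>?S. 2 * of_bool (b \<le> x j \<and> b + x j \<le> c j))"
        using fin by (simp add: sum.If_cases of_bool_def Int_def flip: sum_distrib_left)
      also have "\<dots> = (\<Sum>x\<in>?S. \<Psi> x (\<lambda>j. c j - x j))"
        by (intro sum.cong refl) (use xc in \<open>fastforce simp: \<Psi>_def\<close>)
      finally show ?thesis .
    next
      case False
      then have "\<Phi> x (\<lambda>j. c j - x j) = 0" if "x \<in> ?S" for x
        using xc[OF that] by (simp add: \<Phi>_def)
      then have "(\<Sum>x\<in>?S. \<Phi> x (\<lambda>j. c j - x j)) = 0" by simp
      also have "0 \<le> (\<Sum>x\<in>?S. \<Psi> x (\<lambda>j. c j - x j))" by (intro sum_nonneg) (simp add: \<Psi>_def)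
      finally show ?thesis .
    qed
  qed (use assms in auto)
  then show ?thesis
    unfolding table_prob_eq_sum \<Phi>_def \<Psi>_def
    by (simp add: divide_right_mono flip: sum_distrib_left)
qed

text \<open>The column \<open>j\<close> has at most \<open>r j / b\<close> entries of size \<open>b\<close>, whereas a large entry in row
  \<open>i\<close> tends to be accompanied by one of size \<open>b\<close> in each of the other rows of the class.\<close>

lemma entry_tail_step:
  assumes "I \<subseteq> {..<N}" "\<And>k. k \<in> I \<Longrightarrow> r k = R" "i \<in> I" "j < N" "card I \<ge> 2" "b \<ge> 1"
  shows "table_prob N r (\<lambda>X. 4 * b \<le> X i j)
    \<le> 2 * real (r j) / (real b * (real (card I) - 1)) * table_prob N r (\<lambda>X. b \<le> X i j)"
proof -
  let ?T = "real (card (tables N r))"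
  have finI: "finite I" using assms(1) finite_subset by blast
  have cI: "real (card (I - {i})) = real (card I) - 1" using assms finI by simp
  have count: "real b * (\<Sum>k\<in>I-{i}. of_bool (b \<le> X i j \<and> b \<le> X k j)) \<le> real (r j) * of_bool (b \<le> X i j)"
    if "X \<in> tables N r" for X
  proof -
    have "real b * (\<Sum>k\<in>I-{i}. of_bool (b \<le> X i j \<and> b \<le> X k j))
      \<le> (\<Sum>k\<in>I-{i}. real (X k j) * of_bool (b \<le> X i j))"
      unfolding sum_distrib_left by (intro sum_mono) auto
    also have "\<dots> \<le> (\<Sum>k<N. real (X k j) * of_bool (b \<le> X i j))"
      by (intro sum_mono2) (use assms in auto)
    also have "\<dots> = real (r j) * of_bool (b \<le> X i j)"
      using that assms(4) by (simp add: tables_def flip: sum_distrib_right of_nat_sum)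
    finally show ?thesis .
  qed
  have "real b * (real (card I) - 1) * table_prob N r (\<lambda>X. 4 * b \<le> X i j)
     = real b * (\<Sum>k\<in>I-{i}. table_prob N r (\<lambda>X. 4 * b \<le> X i j))" by (simp add: cI[symmetric])
  also have "\<dots> \<le> real b * (\<Sum>k\<in>I-{i}. 2 * table_prob N r (\<lambda>X. b \<le> X i j \<and> b \<le> X k j))"
    by (intro mult_left_mono sum_mono large_entry_spreads) (use assms in auto)
  also have "\<dots> = 2 * (\<Sum>X\<in>tables N r. real b * (\<Sum>k\<in>I-{i}. of_bool (b \<le> X i j \<and> b \<le> X k j))) / ?T"
    unfolding table_prob_eq_sum
    by (simp add: sum_distrib_left sum_divide_distrib mult_ac) (rule sum.swap)
  also have "\<dots> \<le> 2 * (\<Sum>X\<in>tables N r. real (r j) * of_bool (b \<le> X i j)) / ?T"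
    by (intro divide_right_mono mult_left_mono sum_mono count) auto
  also have "\<dots> = 2 * real (r j) * table_prob N r (\<lambda>X. b \<le> X i j)"
    unfolding table_prob_eq_sum by (simp flip: sum_distrib_left)
  finally show ?thesis using assms(5,6) by (simp add: field_simps)
qed

text \<open>The column sum over the number of rows is the typical order of an entry.  Once \<open>b\<close> exceeds it by a
  positive power of the size of the table, a bounded number of steps yields any polynomial decay.\<close>

lemma entry_tail:
  assumes "I \<subseteq> {..<N}" "\<And>k. k \<in> I \<Longrightarrow> r k = R" "i \<in> I" "j < N" "card I \<ge> 2" "b \<ge> 1"
  shows "table_prob N r (\<lambda>X. 4 ^ n * b \<le> X i j) \<le> (2 * real (r j) / (real b * (real (card I) - 1))) ^ n"
proof (induction n)
  case 0
  then show ?case by (simp add: table_prob_le_1)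
next
  case (Suc n)
  let ?q = "2 * real (r j) / (real b * (real (card I) - 1))"
  have "1 \<le> 4 ^ n * b" using assms(6) by simp
  with assms have "table_prob N r (\<lambda>X. 4 * (4 ^ n * b) \<le> X i j)
    \<le> 2 * real (r j) / (real (4 ^ n * b) * (real (card I) - 1)) * table_prob N r (\<lambda>X. 4 ^ n * b \<le> X i j)"
    by (intro entry_tail_step) auto
  then have "table_prob N r (\<lambda>X. 4 ^ Suc n * b \<le> X i j)
    \<le> 2 * real (r j) / (real (4 ^ n * b) * (real (card I) - 1)) * table_prob N r (\<lambda>X. 4 ^ n * b \<le> X i j)"
    by (simp add: mult_ac)
  also have "\<dots> \<le> ?q * ?q ^ n"
  proof (intro mult_mono Suc.IH table_prob_nonneg)
    have "1 * (real b * (real (card I) - 1)) \<le> 4 ^ n * (real b * (real (card I) - 1))"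
      by (intro mult_right_mono) (use assms in auto)
    then show "2 * real (r j) / (real (4 ^ n * b) * (real (card I) - 1)) \<le> ?q"
      using assms(5,6) by (intro divide_left_mono) (auto simp: mult_ac)
  qed (use assms in auto)
  finally show ?case by simp
qed

section \<open>Concentration for pairs of rows\<close>

text \<open>A function \<open>f\<close> whose sum vanishes on every fibre \<open>x + y = c\<close> has mean zero under the uniform law
  of one coordinate of the box, which is what Hoeffding's inequality needs.  The bound on the
  entries forces \<open>c j \<le> 2 * K\<close>, which depends on the fibre only, and there \<open>f\<close> is bounded by \<open>L\<close>.\<close>

lemma pair_concentration:
  fixes f :: "nat \<Rightarrow> nat \<Rightarrow> real" and L t :: real and R :: nat
  assumes ik: "i < N" "k < N" "i \<noteq> k" and R: "r i = R" "r k = R"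
    and J: "J \<subseteq> {..<N}" "J \<noteq> {}"
    and f: "\<And>c. (\<Sum>x\<le>c. f x (c - x)) = 0" "\<And>x y. x + y \<le> 2 * K \<Longrightarrow> \<bar>f x y\<bar> \<le> L"
    and pos: "L > 0" "t > 0"
  shows "table_prob N r (\<lambda>X. (\<forall>j\<in>J. X i j \<le> K \<and> X k j \<le> K) \<and> t \<le> \<bar>\<Sum>j\<in>J. f (X i j) (X k j)\<bar>)
    \<le> 2 * (2 * real R + 1) * exp (- (t\<^sup>2 / (2 * L\<^sup>2 * card J)))"
proof -
  let ?e = "2 * (2 * real R + 1) * exp (- (t\<^sup>2 / (2 * L\<^sup>2 * card J)))"
  define \<Phi> :: "(nat \<Rightarrow> nat) \<Rightarrow> (nat \<Rightarrow> nat) \<Rightarrow> real" where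
    "\<Phi> x y = of_bool ((\<forall>j\<in>J. x j \<le> K \<and> y j \<le> K) \<and> t \<le> \<bar>\<Sum>j\<in>J. f (x j) (y j)\<bar>)" for x y
  have "(\<Sum>X\<in>tables N r. \<Phi> (X i) (X k)) \<le> (\<Sum>X\<in>tables N r. ?e)"
  proof (rule resampling_two_rows[where R = R, OF ik R])
    fix c :: "nat \<Rightarrow> nat" assume c: "sum c {..<N} = 2 * R"
    let ?S = "slice {..<N} c R"
    have fin: "finite ?S" by (rule finite_slice) simp
    have xc: "x j \<le> c j" if "x \<in> ?S" "j \<in> J" for x j
      using that J by (auto simp: slice_def subvecs_def)
    show "(\<Sum>x\<in>?S. \<Phi> x (\<lambda>j. c j - x j)) \<le> (\<Sum>x\<in>?S. ?e)"
    proof (cases "\<forall>j\<in>J. c j \<le> 2 * K")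
      case True
      have "(\<Sum>x\<in>?S. \<Phi> x (\<lambda>j. c j - x j)) \<le> (\<Sum>x\<in>?S. of_bool (t \<le> \<bar>\<Sum>j\<in>J. f (x j) (c j - x j)\<bar>))"
        by (intro sum_mono) (simp add: \<Phi>_def)
      also have "\<dots> = card {x \<in> ?S. t \<le> \<bar>\<Sum>j\<in>J. f (x j) (c j - x j)\<bar>}"
        using fin by (simp add: sum.If_cases of_bool_def Int_def)
      also have "\<dots> \<le> ?e * card ?S"
        by (rule middle_slice_concentration[OF _ c J, where \<phi> = "\<lambda>j x. f x (c j - x)"])
          (use True f pos in auto)
      finally show ?thesis by (simp add: mult.commute)
    next
      case False
      then have "\<Phi> x (\<lambda>j. c j - x j) = 0" if x: "x \<in> ?S" for x
      proof -
        from False obtain j where j: "j \<in> J" "2 * K < c j" by (auto simp: not_le)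
        then have "\<not> (x j \<le> K \<and> c j - x j \<le> K)" using xc[OF x j(1)] by auto
        with j show ?thesis unfolding \<Phi>_def by auto
      qed
      then have "(\<Sum>x\<in>?S. \<Phi> x (\<lambda>j. c j - x j)) = 0" by simp
      also have "0 \<le> (\<Sum>x\<in>?S. ?e)" by (intro sum_nonneg) simp
      finally show ?thesis .
    qed
  qed
  then show ?thesis
    unfolding table_prob_eq_sum \<Phi>_def
    using card_tables_pos[of N r] by (simp add: divide_le_eq mult.commute)
qed

text \<open>For \<open>f\<close> the difference, the event that two rows in \<open>I\<close> have sums over \<open>J\<close> that differ by at
  least \<open>t\<close>; the general \<open>f\<close> allows for other statistics that balance between exchangeable rows.\<close>

definition disagree :: "(nat \<Rightarrow> nat \<Rightarrow> real) \<Rightarrow> real \<Rightarrow> nat set \<Rightarrow> nat set \<Rightarrow> (nat \<Rightarrow> nat \<Rightarrow> nat) \<Rightarrow> bool" where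
  "disagree f t I J X \<longleftrightarrow> (\<exists>i\<in>I. \<exists>k\<in>I. i \<noteq> k \<and> t \<le> \<bar>\<Sum>j\<in>J. f (X i j) (X k j)\<bar>)"

lemma not_disagreeD:
  assumes "\<not> disagree f t I J X" "i \<in> I" "k \<in> I" "i \<noteq> k"
  shows "\<bar>\<Sum>j\<in>J. f (X i j) (X k j)\<bar> \<le> t"
proof (rule ccontr)
  assume "\<not> ?thesis"
  then have "t \<le> \<bar>\<Sum>j\<in>J. f (X i j) (X k j)\<bar>" by simp
  with assms show False unfolding disagree_def by blast
qed

lemma all_pairs_concentration:
  fixes f :: "nat \<Rightarrow> nat \<Rightarrow> real" and L t :: real and R :: nat
  assumes I: "I \<subseteq> {..<N}" "\<And>i. i \<in> I \<Longrightarrow> r i = R"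
    and J: "J \<subseteq> {..<N}" "J \<noteq> {}"
    and f: "\<And>c. (\<Sum>x\<le>c. f x (c - x)) = 0" "\<And>x y. x + y \<le> 2 * K \<Longrightarrow> \<bar>f x y\<bar> \<le> L"
    and pos: "L > 0" "t > 0"
  shows "table_prob N r (disagree f t I J)
    \<le> (real (card I))\<^sup>2 * (2 * (2 * real R + 1) * exp (- (t\<^sup>2 / (2 * L\<^sup>2 * card J))))
      + table_prob N r (\<lambda>X. \<exists>i\<in>I. \<exists>j\<in>J. K < X i j)"
proof -
  let ?e = "2 * (2 * real R + 1) * exp (- (t\<^sup>2 / (2 * L\<^sup>2 * card J)))"
  define Q where "Q = (\<lambda>(i :: nat, k :: nat) (X :: nat \<Rightarrow> nat \<Rightarrow> nat). i \<noteq> k \<and> (\<forall>j\<in>J. X i j \<le> K \<and> X k j \<le> K) \<and> t \<le> \<bar>\<Sum>j\<in>J. f (X i j) (X k j)\<bar>)"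
  have finI: "finite I" using I finite_subset by blast
  have "table_prob N r (Q a) \<le> ?e" if "a \<in> I \<times> I" for a
  proof (cases "fst a = snd a")
    case True
    then show ?thesis by (simp add: Q_def split_beta table_prob_def)
  next
    case False
    then show ?thesis
      using pair_concentration[OF _ _ False _ _ J f pos] that I
      by (auto simp: Q_def split_beta subset_iff)
  qed
  then have "table_prob N r (\<lambda>X. \<exists>a\<in>I\<times>I. Q a X) \<le> card (I \<times> I) * ?e"
    using finI by (intro table_prob_bex) auto
  moreover have "table_prob N r (disagree f t I J)
    \<le> table_prob N r (\<lambda>X. (\<exists>a\<in>I\<times>I. Q a X) \<or> (\<exists>i\<in>I. \<exists>j\<in>J. K < X i j))"
  proof (rule table_prob_mono)
    fix X assume "disagree f t I J X"
    then obtain i k where ik: "i \<in> I" "k \<in> I" "i \<noteq> k" "t \<le> \<bar>\<Sum>j\<in>J. f (X i j) (X k j)\<bar>"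
      unfolding disagree_def by blast
    show "(\<exists>a\<in>I\<times>I. Q a X) \<or> (\<exists>i\<in>I. \<exists>j\<in>J. K < X i j)"
    proof (rule disjCI)
      assume "\<not> (\<exists>i\<in>I. \<exists>j\<in>J. K < X i j)"
      then have "Q (i, k) X" using ik by (simp add: Q_def not_less)
      with ik show "\<exists>a\<in>I\<times>I. Q a X" by blast
    qed
  qed
  moreover note table_prob_disj[of N r "\<lambda>X. \<exists>a\<in>I\<times>I. Q a X" "\<lambda>X. \<exists>i\<in>I. \<exists>j\<in>J. K < X i j"]
  ultimately show ?thesis by (simp add: card_cartesian_product power2_eq_square)
qed

lemma block_entry_tail:
  assumes "I \<subseteq> {..<N}" "\<And>k. k \<in> I \<Longrightarrow> r k = R" "J \<subseteq> {..<N}" "\<And>j. j \<in> J \<Longrightarrow> r j \<le> M"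
    "card I \<ge> 2" "b \<ge> 1"
  shows "table_prob N r (\<lambda>X. \<exists>i\<in>I. \<exists>j\<in>J. 4 ^ n * b \<le> X i j)
    \<le> real (card I) * real (card J) * (2 * real M / (real b * (real (card I) - 1))) ^ n"
proof -
  let ?e = "(2 * real M / (real b * (real (card I) - 1))) ^ n"
  have fin: "finite (I \<times> J)" using assms(1,3) finite_subset by blast
  have each: "table_prob N r (\<lambda>X. case a of (i, j) \<Rightarrow> 4 ^ n * b \<le> X i j) \<le> ?e" if "a \<in> I \<times> J" for a
  proof -
    obtain i j where a: "a = (i, j)" "i \<in> I" "j \<in> J" "j < N" using \<open>a \<in> I \<times> J\<close> assms by auto
    have "table_prob N r (\<lambda>X. 4 ^ n * b \<le> X i j) \<le> (2 * real (r j) / (real b * (real (card I) - 1))) ^ n"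
      by (rule entry_tail) (use assms a in auto)
    also have "\<dots> \<le> ?e"
      by (intro power_mono divide_right_mono) (use assms a in auto)
    finally show ?thesis by (simp add: a)
  qed
  have "table_prob N r (\<lambda>X. \<exists>a\<in>I \<times> J. case a of (i, j) \<Rightarrow> 4 ^ n * b \<le> X i j) \<le> card (I \<times> J) * ?e"
    using fin each by (rule table_prob_bex)
  then show ?thesis by (simp add: card_cartesian_product)
qed

section \<open>The proportion of positive entries in a block\<close>

text \<open>On the fibre \<open>a + b = c\<close> both terms sum to \<open>c\<close>.  For independent variables with a common law the
  vanishing of the expectation says that the mean times the probability of zero is the probability of being
  positive, as it is for geometric variables.\<close>

definition zero_balance :: "nat \<Rightarrow> nat \<Rightarrow> real" where
  "zero_balance a b = real a * of_bool (b = 0) - of_bool (0 < a)"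

lemma zero_balance_fibre_sum: "(\<Sum>x\<le>c. zero_balance x (c - x)) = 0"
proof -
  have "(\<Sum>x\<le>c. real x * of_bool (c - x = 0)) = (\<Sum>x\<in>{c}. real x)"
    by (rule sum.mono_neutral_cong_right) auto
  moreover have "(\<Sum>x\<le>c. of_bool (0 < x) :: real) = (\<Sum>x\<in>{1..c}. 1)"
    by (rule sum.mono_neutral_cong_right) auto
  ultimately show ?thesis by (simp add: zero_balance_def sum_subtractf)
qed

lemma abs_zero_balance_le: "x + y \<le> 2 * K \<Longrightarrow> \<bar>zero_balance x y\<bar> \<le> 2 * real K"
  by (auto simp: zero_balance_def)

abbreviation difference :: "nat \<Rightarrow> nat \<Rightarrow> real" where
  "difference x y \<equiv> real x - real y"

lemma difference_fibre_sum: "(\<Sum>x\<le>c. real x - real (c - x)) = 0"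
proof -
  have "(\<Sum>x\<le>c. real (c - x)) = (\<Sum>x\<le>c. real x)"
    by (rule sum.reindex_bij_witness[where i = "\<lambda>k. c - k" and j = "\<lambda>k. c - k"]) auto
  then show ?thesis by (simp only: sum_subtractf diff_self)
qed

definition npos :: "(nat \<Rightarrow> nat \<Rightarrow> nat) \<Rightarrow> nat set \<Rightarrow> nat set \<Rightarrow> real" where
  "npos X I J = (\<Sum>i\<in>I. \<Sum>j\<in>J. of_bool (0 < X i j))"

lemma npos_nonneg: "npos X I J \<ge> 0"
  unfolding npos_def by (intro sum_nonneg) auto

lemma npos_le: "npos X I J \<le> real (card I) * real (card J)"
proof -
  have "npos X I J \<le> (\<Sum>i\<in>I. \<Sum>j\<in>J. 1)" unfolding npos_def by (intro sum_mono) auto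
  then show ?thesis by simp
qed

lemma zero_balance_pairs_sum:
  assumes "finite I" "finite J"
  shows "(\<Sum>i\<in>I. \<Sum>k\<in>I-{i}. \<Sum>j\<in>J. zero_balance (X i j) (X k j))
    = (\<Sum>j\<in>J. real (\<Sum>i\<in>I. X i j) * (real (card I) - (\<Sum>k\<in>I. of_bool (0 < X k j))))
      - (real (card I) - 1) * npos X I J"
proof -
  have inner: "(\<Sum>k\<in>I-{i}. zero_balance (X i j) (X k j))
     = real (X i j) * (real (card I) - (\<Sum>k\<in>I. of_bool (0 < X k j))) - (real (card I) - 1) * of_bool (0 < X i j)"
    if "i \<in> I" for i j
  proof -
    have z: "(\<Sum>k\<in>I. of_bool (X k j = 0) :: real) = real (card I) - (\<Sum>k\<in>I. of_bool (0 < X k j))"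
    proof -
      have "(\<Sum>k\<in>I. of_bool (X k j = 0) :: real) + (\<Sum>k\<in>I. of_bool (0 < X k j)) = (\<Sum>k\<in>I. 1)"
        unfolding sum.distrib[symmetric] by (rule sum.cong) auto
      then show ?thesis by simp
    qed
    have "(\<Sum>k\<in>I-{i}. zero_balance (X i j) (X k j))
      = (\<Sum>k\<in>I-{i}. real (X i j) * of_bool (X k j = 0)) - (\<Sum>k\<in>I-{i}. of_bool (0 < X i j))"
      by (simp add: zero_balance_def sum_subtractf)
    also have "(\<Sum>k\<in>I-{i}. real (X i j) * of_bool (X k j = 0)) = (\<Sum>k\<in>I. real (X i j) * of_bool (X k j = 0))"
      by (rule sum.mono_neutral_left) (use assms in auto)
    also have "(\<Sum>k\<in>I-{i}. of_bool (0 < X i j)) = (real (card I) - 1) * of_bool (0 < X i j)"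
      by (simp add: card.remove[OF assms(1) that] del: card_Diff_insert)
    finally show ?thesis by (simp add: z flip: sum_distrib_left)
  qed
  have "(\<Sum>i\<in>I. \<Sum>k\<in>I-{i}. \<Sum>j\<in>J. zero_balance (X i j) (X k j))
    = (\<Sum>i\<in>I. \<Sum>j\<in>J. \<Sum>k\<in>I-{i}. zero_balance (X i j) (X k j))"
    by (intro sum.cong refl sum.swap)
  also have "\<dots> = (\<Sum>i\<in>I. \<Sum>j\<in>J. real (X i j) * (real (card I) - (\<Sum>k\<in>I. of_bool (0 < X k j)))
      - (real (card I) - 1) * of_bool (0 < X i j))"
    by (intro sum.cong refl inner)
  also have "\<dots> = (\<Sum>i\<in>I. \<Sum>j\<in>J. real (X i j) * (real (card I) - (\<Sum>k\<in>I. of_bool (0 < X k j))))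
      - (real (card I) - 1) * npos X I J"
    by (simp add: sum_subtractf npos_def sum_distrib_left)
  also have "(\<Sum>i\<in>I. \<Sum>j\<in>J. real (X i j) * (real (card I) - (\<Sum>k\<in>I. of_bool (0 < X k j))))
     = (\<Sum>j\<in>J. real (\<Sum>i\<in>I. X i j) * (real (card I) - (\<Sum>k\<in>I. of_bool (0 < X k j))))"
    by (subst sum.swap) (simp add: sum_distrib_right)
  finally show ?thesis .
qed

text \<open>Summing \<open>zero_balance\<close> over all pairs of rows of the block gives, column by column, the product of the
  column sum and the number of zeros, minus the number of positive entries for each other row.  When all column sums
  are near \<open>v\<close>, only the number of positive entries of the block remains unknown.\<close>

lemma block_positive_count:
  fixes e1 e2 v :: real
  assumes fin: "finite I" "finite J" and e: "e1 \<ge> 0" "e2 \<ge> 0"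
    and bal: "\<And>i k. i \<in> I \<Longrightarrow> k \<in> I \<Longrightarrow> i \<noteq> k \<Longrightarrow> \<bar>\<Sum>j\<in>J. zero_balance (X i j) (X k j)\<bar> \<le> e1"
    and col: "\<And>j. j \<in> J \<Longrightarrow> \<bar>real (\<Sum>i\<in>I. X i j) - v\<bar> \<le> e2"
  defines "p \<equiv> real (card I)" and "q \<equiv> real (card J)"
  shows "\<bar>v * (p * q - npos X I J) - (p - 1) * npos X I J\<bar> \<le> p\<^sup>2 * e1 + p * q * e2"
proof -
  define V where "V j = real (\<Sum>i\<in>I. X i j)" for j
  define P where "P j = (\<Sum>k\<in>I. of_bool (0 < X k j) :: real)" for j
  have P: "0 \<le> P j" "P j \<le> p" for j
  proof -
    show "0 \<le> P j" unfolding P_def by (intro sum_nonneg) auto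
    have "P j \<le> (\<Sum>k\<in>I. 1)" unfolding P_def by (intro sum_mono) auto
    then show "P j \<le> p" by (simp add: p_def)
  qed
  have nP: "npos X I J = (\<Sum>j\<in>J. P j)" unfolding npos_def P_def by (rule sum.swap)
  have "\<bar>\<Sum>i\<in>I. \<Sum>k\<in>I-{i}. \<Sum>j\<in>J. zero_balance (X i j) (X k j)\<bar> \<le> (\<Sum>i\<in>I. \<Sum>k\<in>I-{i}. e1)"
    by (rule sum_abs[THEN order_trans], rule sum_mono, rule sum_abs[THEN order_trans], rule sum_mono)
      (use bal in auto)
  also have "\<dots> \<le> (\<Sum>i\<in>I. \<Sum>k\<in>I. e1)"
    by (intro sum_mono sum_mono2) (use fin e in auto)
  also have "\<dots> = p\<^sup>2 * e1" by (simp add: p_def power2_eq_square)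
  finally have 1: "\<bar>(\<Sum>j\<in>J. V j * (p - P j)) - (p - 1) * npos X I J\<bar> \<le> p\<^sup>2 * e1"
    unfolding zero_balance_pairs_sum[OF fin] V_def P_def p_def .
  have "\<bar>\<Sum>j\<in>J. (v - V j) * (p - P j)\<bar> \<le> (\<Sum>j\<in>J. e2 * p)"
  proof (rule sum_abs[THEN order_trans], rule sum_mono)
    fix j assume "j \<in> J"
    then show "\<bar>(v - V j) * (p - P j)\<bar> \<le> e2 * p"
      unfolding abs_mult using col[of j] P[of j] e
      by (intro mult_mono) (auto simp: V_def abs_minus_commute)
  qed
  moreover have "(\<Sum>j\<in>J. (v - V j) * (p - P j)) = v * (p * q - npos X I J) - (\<Sum>j\<in>J. V j * (p - P j))"
    by (simp add: left_diff_distrib right_diff_distrib sum_subtractf nP sum_distrib_left q_def)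
  ultimately have "\<bar>v * (p * q - npos X I J) - (\<Sum>j\<in>J. V j * (p - P j))\<bar> \<le> p * q * e2"
    by (simp add: q_def mult_ac)
  with 1 show ?thesis by linarith
qed

section \<open>Switching along two by two minors\<close>

text \<open>Natural subtraction is harmless here, because the map is applied only to tables in which the two decreased entries
  are positive.\<close>

definition switch :: "nat \<Rightarrow> nat \<Rightarrow> nat \<Rightarrow> nat \<Rightarrow> (nat \<Rightarrow> nat \<Rightarrow> nat) \<Rightarrow> nat \<Rightarrow> nat \<Rightarrow> nat" where
  "switch i j k l X = (\<lambda>a b.
     if (a = i \<and> b = j) \<or> (a = k \<and> b = l) then X a b + 1
     else if (a = i \<and> b = l) \<or> (a = k \<and> b = j) then X a b - 1 else X a b)"

lemma switch_row_sum:
  assumes "i \<noteq> k" "j \<noteq> l" "j < N" "l < N" "0 < X i l" "0 < X k j"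
  shows "(\<Sum>b<N. switch i j k l X a b) = (\<Sum>b<N. X a b)"
proof -
  have rest: "(\<Sum>b\<in>{..<N} - {j, l}. switch i j k l X a b) = (\<Sum>b\<in>{..<N} - {j, l}. X a b)"
    by (rule sum.cong) (auto simp: switch_def)
  have "switch i j k l X a j + switch i j k l X a l = X a j + X a l"
    using assms by (auto simp: switch_def)
  then show ?thesis
    unfolding sum_split_two[OF assms(3,4,2)] rest by simp
qed

lemma switch_flip: "switch i j k l X a b = switch j i l k (flip X) b a"
  unfolding switch_def flip_def by (intro if_cong) blast+

lemma switch_in_tables:
  assumes "i \<noteq> k" "j \<noteq> l" "i < N" "k < N" "j < N" "l < N" "0 < X i l" "0 < X k j" "X \<in> tables N r"
  shows "switch i j k l X \<in> tables N r"
proof -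
  have "(\<Sum>a<N. switch i j k l X a b) = (\<Sum>a<N. X a b)" for b
    by (subst switch_flip) (rule switch_row_sum[where X = "flip X", THEN trans]; use assms in \<open>simp add: flip_def\<close>)
  moreover have "(\<Sum>b<N. switch i j k l X a b) = (\<Sum>b<N. X a b)" for a
    by (rule switch_row_sum) (use assms in simp_all)
  moreover have "switch i j k l X a b = X a b" if "N \<le> a \<or> N \<le> b" for a b
    using that assms(3-6) by (auto simp: switch_def)
  ultimately show ?thesis using assms(9) by (simp add: tables_def)
qed

text \<open>Switches along the two diagonals of the same minor are inverse to each other.\<close>

lemma switch_sum:
  fixes g :: "(nat \<Rightarrow> nat \<Rightarrow> nat) \<Rightarrow> real"
  assumes "i \<noteq> k" "j \<noteq> l" "i < N" "k < N" "j < N" "l < N"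
  shows "(\<Sum>X\<in>tables N r. of_bool (0 < X i j \<and> 0 < X k l) * g X)
    = (\<Sum>X\<in>tables N r. of_bool (0 < X i l \<and> 0 < X k j) * g (switch i j k l X))"
proof -
  have inv: "switch i l k j (switch i j k l X) = X" if "j \<noteq> l" "0 < X i l" "0 < X k j" for X j l
    using that assms(1) by (auto simp: switch_def fun_eq_iff)
  have "(\<Sum>X | X \<in> tables N r \<and> 0 < X i j \<and> 0 < X k l. g X)
    = (\<Sum>X | X \<in> tables N r \<and> 0 < X i l \<and> 0 < X k j. g (switch i j k l X))"
    by (rule sum.reindex_bij_witness[where i = "switch i j k l" and j = "switch i l k j"])
      (use assms switch_in_tables in \<open>auto simp: inv\<close>, auto simp: switch_def)
  then show ?thesis
    by (simp add: of_bool_def if_distrib[of "\<lambda>x. x * _"] sum.If_cases[OF finite_tables] Int_def cong: if_cong)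
qed

definition block_sum :: "(nat \<Rightarrow> nat \<Rightarrow> nat) \<Rightarrow> nat set \<Rightarrow> nat set \<Rightarrow> nat" where
  "block_sum X I J = (\<Sum>i\<in>I. \<Sum>j\<in>J. X i j)"

lemma block_sum_switch:
  assumes "i < m" "j < m" "m \<le> k" "m \<le> l"
  shows "block_sum (switch i j k l X) {..<m} {..<m} = block_sum X {..<m} {..<m} + 1"
proof -
  have "block_sum (switch i j k l X) {..<m} {..<m}
     = (\<Sum>a<m. \<Sum>b<m. X a b + (if a = i then if b = j then 1 else 0 else 0))"
    unfolding block_sum_def by (intro sum.cong refl) (use assms in \<open>auto simp: switch_def\<close>)
  also have "\<dots> = block_sum X {..<m} {..<m} + (\<Sum>a<m. if a = i then \<Sum>b<m. if b = j then 1 else 0 else 0)"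
    unfolding block_sum_def sum.distrib by (intro arg_cong2[where f = "(+)"] refl sum.cong) auto
  also have "\<dots> = block_sum X {..<m} {..<m} + 1" using assms by simp
  finally show ?thesis .
qed

lemma sum_product_blocks:
  fixes f g :: "nat \<Rightarrow> nat \<Rightarrow> real"
  shows "(\<Sum>i\<in>A. \<Sum>j\<in>B. f i j) * (\<Sum>k\<in>C. \<Sum>l\<in>D. g k l)
    = (\<Sum>i\<in>A. \<Sum>j\<in>B. \<Sum>k\<in>C. \<Sum>l\<in>D. f i j * g k l)"
  by (simp only: sum_distrib_right) (simp only: sum_distrib_left)

text \<open>Each term is a sum over minors with rows \<open>i\<close>, \<open>k\<close> and columns \<open>j\<close>, \<open>l\<close>, the first of each
  pair special and the second ordinary.  The left side counts the tables in which a unit can be moved out of the special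
  block, the right side those in which a unit can be moved in.\<close>

lemma switching_balance:
  fixes h :: "nat \<Rightarrow> real" and m n :: nat and r :: "nat \<Rightarrow> nat"
  defines "special \<equiv> {..<m}" and "ordinary \<equiv> {m..<m+n}"
  shows "(\<Sum>X\<in>tables (m + n) r. npos X special special * npos X ordinary ordinary * h (block_sum X special special))
    = (\<Sum>X\<in>tables (m + n) r. npos X special ordinary * npos X ordinary special * h (block_sum X special special + 1))"
proof -
  let ?T = "tables (m + n) r"
  have L: "npos X special special * npos X ordinary ordinary = (\<Sum>i\<in>special. \<Sum>j\<in>special. \<Sum>k\<in>ordinary. \<Sum>l\<in>ordinary. of_bool (0 < X i j \<and> 0 < X k l))" for X
    by (simp only: npos_def sum_product_blocks of_bool_conj)
  have G: "npos X special ordinary * npos X ordinary special = (\<Sum>i\<in>special. \<Sum>j\<in>special. \<Sum>k\<in>ordinary. \<Sum>l\<in>ordinary. of_bool (0 < X i l \<and> 0 < X k j))" for X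
  proof -
    have "npos X special ordinary * npos X ordinary special
      = (\<Sum>i\<in>special. \<Sum>l\<in>ordinary. \<Sum>k\<in>ordinary. \<Sum>j\<in>special. of_bool (0 < X i l \<and> 0 < X k j))"
      by (simp only: npos_def sum_product_blocks of_bool_conj)
    also have "\<dots> = (\<Sum>i\<in>special. \<Sum>l\<in>ordinary. \<Sum>j\<in>special. \<Sum>k\<in>ordinary. of_bool (0 < X i l \<and> 0 < X k j))"
      by (intro sum.cong refl sum.swap)
    also have "\<dots> = (\<Sum>i\<in>special. \<Sum>j\<in>special. \<Sum>l\<in>ordinary. \<Sum>k\<in>ordinary. of_bool (0 < X i l \<and> 0 < X k j))"
      by (intro sum.cong refl sum.swap)
    also have "\<dots> = (\<Sum>i\<in>special. \<Sum>j\<in>special. \<Sum>k\<in>ordinary. \<Sum>l\<in>ordinary. of_bool (0 < X i l \<and> 0 < X k j))"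
      by (intro sum.cong refl sum.swap)
    finally show ?thesis .
  qed
  have pull: "(\<Sum>X\<in>?T. (\<Sum>i\<in>special. \<Sum>j\<in>special. \<Sum>k\<in>ordinary. \<Sum>l\<in>ordinary. A X i j k l) * H X)
     = (\<Sum>i\<in>special. \<Sum>j\<in>special. \<Sum>k\<in>ordinary. \<Sum>l\<in>ordinary. \<Sum>X\<in>?T. A X i j k l * H X)"
    for A :: "(nat \<Rightarrow> nat \<Rightarrow> nat) \<Rightarrow> nat \<Rightarrow> nat \<Rightarrow> nat \<Rightarrow> nat \<Rightarrow> real" and H
    by (simp only: sum_distrib_right sum.swap[of _ _ ?T])
  show ?thesis
    unfolding L G pull
  proof (rule sum.cong[OF refl], rule sum.cong[OF refl], rule sum.cong[OF refl], rule sum.cong[OF refl])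
    fix i j k l assume "i \<in> special" "j \<in> special" "k \<in> ordinary" "l \<in> ordinary"
    then have *: "i < m" "j < m" "m \<le> k" "m \<le> l" "k < m + n" "l < m + n"
      by (auto simp: special_def ordinary_def)
    show "(\<Sum>X\<in>?T. of_bool (0 < X i j \<and> 0 < X k l) * h (block_sum X special special))
      = (\<Sum>X\<in>?T. of_bool (0 < X i l \<and> 0 < X k j) * h (block_sum X special special + 1))"
      using * block_sum_switch[OF *(1-4)]
      by (subst switch_sum) (auto simp: special_def)
  qed
qed

section \<open>Tails from drift\<close>

text \<open>The balance hypothesis is detailed balance for a chain that lowers \<open>T\<close> at rate \<open>F\<close> and raises it at
  rate \<open>G\<close>.  Above \<open>\<tau>\<close> the first rate exceeds the second by \<open>g\<close> outside the bad set, so the mass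
  of the level \<open>t\<close>, weighted by \<open>F\<close>, decreases by the factor \<open>1 - g\<close> in each step.  The bad set
  is charged level by level and thus only once in total.\<close>

lemma drift_tail:
  fixes F G :: "'a \<Rightarrow> real" and T :: "'a \<Rightarrow> nat" and g :: real
  assumes fin: "finite \<Omega>"
    and F: "\<And>X. X \<in> \<Omega> \<Longrightarrow> 0 \<le> F X" "\<And>X. X \<in> \<Omega> \<Longrightarrow> F X \<le> 1"
    and G: "\<And>X. X \<in> \<Omega> \<Longrightarrow> G X \<le> 1"
    and bal: "\<And>h :: nat \<Rightarrow> real. (\<Sum>X\<in>\<Omega>. F X * h (T X)) = (\<Sum>X\<in>\<Omega>. G X * h (T X + 1))"
    and g: "0 < g" "g \<le> 1"
    and drift: "\<And>X. X \<in> \<Omega> \<Longrightarrow> \<not> bad X \<Longrightarrow> \<tau> \<le> T X \<Longrightarrow> G X \<le> F X - g"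
  shows "g * card {X \<in> \<Omega>. \<tau> + s \<le> T X} \<le> (1 - g) ^ s * card \<Omega> + 2 * real (card {X \<in> \<Omega>. bad X})"
proof -
  define A where "A t = (\<Sum>X\<in>\<Omega>. F X * of_bool (T X = t))" for t
  define B where "B Q = (\<Sum>X\<in>\<Omega>. of_bool (bad X \<and> Q (T X)) :: real)" for Q
  have card_sum: "real (card {X \<in> \<Omega>. Q X}) = (\<Sum>X\<in>\<Omega>. of_bool (Q X))" for Q
    using fin by (simp add: sum.If_cases of_bool_def Int_def)
  have drift': "G X \<le> F X - g + 2 * of_bool (bad X)" if "X \<in> \<Omega>" "\<tau> \<le> T X" for X
    using drift[of X] that F[of X] G[of X] g by (cases "bad X") auto
  have step: "A (Suc t) \<le> (1 - g) * A t + 2 * B (\<lambda>u. u = t)" if "\<tau> \<le> t" for t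
  proof -
    have "A (Suc t) = (\<Sum>X\<in>\<Omega>. G X * of_bool (T X = t))"
      unfolding A_def using bal[of "\<lambda>u. of_bool (u = Suc t)"] by simp
    also have "\<dots> \<le> (\<Sum>X\<in>\<Omega>. (1 - g) * (F X * of_bool (T X = t)) + 2 * of_bool (bad X \<and> T X = t))"
    proof (rule sum_mono)
      fix X assume X: "X \<in> \<Omega>"
      have "g * F X \<le> g * 1" using F[OF X] g by (intro mult_left_mono) auto
      then show "G X * of_bool (T X = t) \<le> (1 - g) * (F X * of_bool (T X = t)) + 2 * of_bool (bad X \<and> T X = t)"
        using drift'[OF X] that by (auto simp: algebra_simps split: if_splits)
    qed
    also have "\<dots> = (1 - g) * A t + 2 * B (\<lambda>u. u = t)"
      by (simp add: A_def B_def sum.distrib sum_distrib_left)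
    finally show ?thesis .
  qed
  have A_le: "A (\<tau> + s) \<le> (1 - g) ^ s * card \<Omega> + 2 * B (\<lambda>u. u < \<tau> + s)" for s
  proof (induction s)
    case 0
    have "A \<tau> \<le> (\<Sum>X\<in>\<Omega>. 1)"
      unfolding A_def by (intro sum_mono) (use F in auto)
    moreover have "0 \<le> B (\<lambda>u. u < \<tau>)" unfolding B_def by (intro sum_nonneg) auto
    ultimately show ?case by simp
  next
    case (Suc s)
    have B0: "0 \<le> B (\<lambda>u. u < \<tau> + s)" unfolding B_def by (intro sum_nonneg) auto
    have Bs: "B (\<lambda>u. u < \<tau> + s) + B (\<lambda>u. u = \<tau> + s) = B (\<lambda>u. u < \<tau> + Suc s)"
      unfolding B_def sum.distrib[symmetric] by (rule sum.cong) auto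
    have "A (\<tau> + Suc s) \<le> (1 - g) * A (\<tau> + s) + 2 * B (\<lambda>u. u = \<tau> + s)"
      using step[of "\<tau> + s"] by simp
    also have "\<dots> \<le> (1 - g) * ((1 - g) ^ s * card \<Omega> + 2 * B (\<lambda>u. u < \<tau> + s)) + 2 * B (\<lambda>u. u = \<tau> + s)"
      using g by (intro add_right_mono mult_left_mono Suc.IH) auto
    also have "\<dots> \<le> (1 - g) ^ Suc s * card \<Omega> + 2 * (B (\<lambda>u. u < \<tau> + s) + B (\<lambda>u. u = \<tau> + s))"
      using mult_nonneg_nonneg[OF less_imp_le[OF g(1)] B0] by (simp add: algebra_simps)
    finally show ?case by (simp only: Bs)
  qed
  \<comment> \<open>the balance for all levels above \<open>\<tau> + s\<close> at once bounds the tail by a single level\<close>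
  let ?t = "\<tau> + s"
  have "(\<Sum>X\<in>\<Omega>. F X * of_bool (?t < T X)) = (\<Sum>X\<in>\<Omega>. G X * of_bool (?t \<le> T X))"
    using bal[of "\<lambda>u. of_bool (?t < u)"] by (simp add: less_Suc_eq_le)
  also have "\<dots> \<le> (\<Sum>X\<in>\<Omega>. F X * of_bool (?t < T X) + F X * of_bool (T X = ?t)
      - g * of_bool (?t \<le> T X) + 2 * of_bool (bad X \<and> ?t \<le> T X))"
    by (intro sum_mono) (use drift' in fastforce)
  also have "\<dots> = (\<Sum>X\<in>\<Omega>. F X * of_bool (?t < T X)) + A ?t
      - g * card {X \<in> \<Omega>. ?t \<le> T X} + 2 * B (\<lambda>u. ?t \<le> u)"
    by (simp add: A_def B_def sum.distrib sum_subtractf sum_distrib_left card_sum)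
  finally have "g * card {X \<in> \<Omega>. ?t \<le> T X} \<le> A ?t + 2 * B (\<lambda>u. ?t \<le> u)" by simp
  also have "\<dots> \<le> (1 - g) ^ s * card \<Omega> + 2 * (B (\<lambda>u. u < ?t) + B (\<lambda>u. ?t \<le> u))"
    using A_le[of s] by simp
  also have "B (\<lambda>u. u < ?t) + B (\<lambda>u. ?t \<le> u) = card {X \<in> \<Omega>. bad X}"
    unfolding B_def card_sum sum.distrib[symmetric] by (rule sum.cong) auto
  finally show ?thesis .
qed

section \<open>Tables with special and ordinary lines\<close>

lemma gaussian_tail_eventually_small:
  fixes A c \<gamma> :: real
  assumes "c > 0" "\<gamma> > 0"
  shows "eventually (\<lambda>n::nat. 8 * (real n)\<^sup>2 * (2 * A * real n + 1) * exp (- (c * real n powr \<gamma>)) \<le> 1 / (real n)\<^sup>2) sequentially"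
proof -
  have "((\<lambda>n::nat. (real n)\<^sup>2 * (8 * (real n)\<^sup>2 * (2 * A * real n + 1) * exp (- (c * real n powr \<gamma>)))) \<longlongrightarrow> 0) sequentially"
    using assms by real_asymp
  then have "eventually (\<lambda>n::nat. (real n)\<^sup>2 * (8 * (real n)\<^sup>2 * (2 * A * real n + 1) * exp (- (c * real n powr \<gamma>))) < 1) sequentially"
    by (rule order_tendstoD(2)) simp
  then show ?thesis using eventually_gt_at_top[of 0]
    by eventually_elim (simp add: field_simps)
qed

lemma half_le_nat_floor: "x \<ge> 1 \<Longrightarrow> x / 2 \<le> real (nat \<lfloor>x\<rfloor>)"
proof -
  assume x: "x \<ge> 1"
  then have "1 \<le> \<lfloor>x\<rfloor>" by simp
  then show ?thesis using floor_correct[of x] by linarith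
qed

locale phase_parameters =
  fixes B C \<delta> :: real
  assumes B_pos: "B > 0" and C_pos: "C > 0" and \<delta>_nonneg: "0 \<le> \<delta>" and \<delta>_less: "\<delta> < 1"
begin

text \<open>Of the \<open>m n + n\<close> lines of a table the \<open>m n\<close> special ones have the margin \<open>R n\<close> and the
  \<open>n\<close> ordinary ones the margin \<open>S n\<close>.\<close>

definition m :: "nat \<Rightarrow> nat" where "m n = num_special n \<delta>"
definition R :: "nat \<Rightarrow> nat" where "R n = nat \<lfloor>B * C * real n\<rfloor>"
definition S :: "nat \<Rightarrow> nat" where "S n = nat \<lfloor>C * real n\<rfloor>"
definition special :: "nat \<Rightarrow> nat set" where "special n = {..<m n}"
definition ordinary :: "nat \<Rightarrow> nat set" where "ordinary n = {m n..<m n + n}"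
definition samples :: "nat \<Rightarrow> (nat \<Rightarrow> nat \<Rightarrow> nat) set" where "samples n = tables (m n + n) (margin n \<delta> B C)"
definition sample_prob :: "nat \<Rightarrow> ((nat \<Rightarrow> nat \<Rightarrow> nat) \<Rightarrow> bool) \<Rightarrow> real" where
  "sample_prob n = table_prob (m n + n) (margin n \<delta> B C)"

text \<open>Summability is all that the Borel--Cantelli lemma asks for, and it is stable under finite unions and under
  transposition.\<close>

definition rare :: "(nat \<Rightarrow> (nat \<Rightarrow> nat \<Rightarrow> nat) \<Rightarrow> bool) \<Rightarrow> bool" where
  "rare Q \<longleftrightarrow> summable (\<lambda>n. sample_prob n (Q n))"

lemma margin_special: "i \<in> special n \<Longrightarrow> margin n \<delta> B C i = R n"
  and margin_ordinary: "i \<in> ordinary n \<Longrightarrow> margin n \<delta> B C i = S n"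
  by (auto simp: special_def ordinary_def margin_def m_def R_def S_def)

lemma block_sets: "finite (special n)" "finite (ordinary n)" "card (special n) = m n" "card (ordinary n) = n"
  "special n \<subseteq> {..<m n + n}" "ordinary n \<subseteq> {..<m n + n}"
  "special n \<inter> ordinary n = {}" "{..<m n + n} = special n \<union> ordinary n"
  by (auto simp: special_def ordinary_def)

lemma m_bounds:
  assumes "n \<ge> 1"
  shows "real n powr \<delta> / 2 \<le> real (m n)" "real (m n) \<le> real n powr \<delta>" "1 \<le> m n" "m n \<le> n"
proof -
  have 1: "1 \<le> real n powr \<delta>" using assms \<delta>_nonneg by (simp add: ge_one_powr_ge_zero)
  show "real n powr \<delta> / 2 \<le> real (m n)" unfolding m_def num_special_def using half_le_nat_floor[OF 1] .
  show le: "real (m n) \<le> real n powr \<delta>" unfolding m_def num_special_def using 1 by linarith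
  show "1 \<le> m n" unfolding m_def num_special_def using 1 by linarith
  have "real n powr \<delta> \<le> real n powr 1" using assms \<delta>_less by (intro powr_mono) auto
  then have "real (m n) \<le> real n" using le assms by simp
  then show "m n \<le> n" by simp
qed

lemma R_bounds: "real (R n) \<le> B * C * real n" "B * C * real n - 1 \<le> real (R n)"
proof -
  have "0 \<le> B * C * real n" using B_pos C_pos by simp
  then show "real (R n) \<le> B * C * real n" "B * C * real n - 1 \<le> real (R n)"
    unfolding R_def by linarith+
qed

lemma S_bounds: "real (S n) \<le> C * real n" "C * real n - 1 \<le> real (S n)"
proof -
  have "0 \<le> C * real n" using C_pos by simp
  then show "real (S n) \<le> C * real n" "C * real n - 1 \<le> real (S n)"
    unfolding S_def by linarith+
qed

lemma sample_prob_nonneg: "0 \<le> sample_prob n Q"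
  by (simp add: sample_prob_def table_prob_nonneg)

lemma rare_mono:
  assumes "rare Q'" "eventually (\<lambda>n. \<forall>X\<in>samples n. Q n X \<longrightarrow> Q' n X) sequentially"
  shows "rare Q"
  unfolding rare_def
proof (rule summable_comparison_test_ev)
  show "summable (\<lambda>n. sample_prob n (Q' n))" using assms by (simp add: rare_def)
  show "eventually (\<lambda>n. norm (sample_prob n (Q n)) \<le> sample_prob n (Q' n)) sequentially"
    using assms(2)
    by eventually_elim (auto simp: sample_prob_nonneg sample_prob_def table_prob_nonneg samples_def intro!: table_prob_mono)
qed

lemma rare_disj:
  assumes "rare Q" "rare Q'"
  shows "rare (\<lambda>n X. Q n X \<or> Q' n X)"
  unfolding rare_def
proof (rule summable_comparison_test_ev)
  show "summable (\<lambda>n. sample_prob n (Q n) + sample_prob n (Q' n))" using assms by (simp add: rare_def summable_add)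
qed (simp add: sample_prob_nonneg sample_prob_def table_prob_nonneg table_prob_disj)

lemma rare_flip: "rare Q \<Longrightarrow> rare (\<lambda>n X. Q n (flip X))"
  by (simp add: rare_def sample_prob_def table_prob_flip)

lemma summable_inverse_square: "summable (\<lambda>n. A / (real n)\<^sup>2)"
  using summable_mult[OF inverse_power_summable[of 2, where 'a = real], of A] by (simp add: field_simps)

lemma rareI_inverse_square:
  assumes "eventually (\<lambda>n. sample_prob n (Q n) \<le> A / (real n)\<^sup>2) sequentially"
  shows "rare Q"
  unfolding rare_def
  by (rule summable_comparison_test_ev[OF _ summable_inverse_square[of A]])
    (use assms in \<open>simp add: sample_prob_nonneg\<close>)

lemma card_le_2n:
  assumes "n \<ge> 1" "I \<subseteq> {..<m n + n}"
  shows "real (card I) \<le> 2 * real n"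
  using card_mono[OF _ assms(2)] m_bounds(4)[OF assms(1)] by simp

text \<open>The ratio is the factor gained in one step of \<open>entry_tail\<close>; it is assumed to be of order
  \<open>n powr (- \<eta>)\<close>, so that \<open>4 / \<eta>\<close> steps beat the number of entries by \<open>n\<^sup>2\<close>.\<close>

lemma entries_rare:
  fixes I J :: "nat \<Rightarrow> nat set" and b M \<rho> :: "nat \<Rightarrow> nat"
  assumes \<eta>: "\<eta> > 0"
    and I: "\<And>n. I n \<subseteq> {..<m n + n}" "\<And>n i. i \<in> I n \<Longrightarrow> margin n \<delta> B C i = \<rho> n"
    and J: "\<And>n. J n \<subseteq> {..<m n + n}" "\<And>n j. j \<in> J n \<Longrightarrow> margin n \<delta> B C j \<le> M n"
    and card: "eventually (\<lambda>n. card (I n) \<ge> 2) sequentially"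
    and b: "eventually (\<lambda>n. b n \<ge> 1) sequentially"
    and ratio: "eventually (\<lambda>n. 2 * real (M n) / (real (b n) * (real (card (I n)) - 1)) \<le> A * real n powr (- \<eta>)) sequentially"
  shows "rare (\<lambda>n X. \<exists>i\<in>I n. \<exists>j\<in>J n. 4 ^ nat \<lceil>4 / \<eta>\<rceil> * b n \<le> X i j)"
proof (rule rareI_inverse_square)
  define k where "k = nat \<lceil>4 / \<eta>\<rceil>"
  have k: "4 \<le> \<eta> * real k"
  proof -
    have "4 / \<eta> \<le> real k" unfolding k_def by linarith
    then show ?thesis using \<eta> by (simp add: field_simps)
  qed
  show "eventually (\<lambda>n. sample_prob n (\<lambda>X. \<exists>i\<in>I n. \<exists>j\<in>J n. 4 ^ nat \<lceil>4 / \<eta>\<rceil> * b n \<le> X i j) \<le> 4 * \<bar>A\<bar> ^ k / (real n)\<^sup>2) sequentially"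
    using card b ratio eventually_ge_at_top[of 1]
  proof eventually_elim
    case (elim n)
    let ?q = "2 * real (M n) / (real (b n) * (real (card (I n)) - 1))"
    have "sample_prob n (\<lambda>X. \<exists>i\<in>I n. \<exists>j\<in>J n. 4 ^ nat \<lceil>4 / \<eta>\<rceil> * b n \<le> X i j) \<le> real (card (I n)) * real (card (J n)) * ?q ^ k"
      unfolding sample_prob_def k_def by (rule block_entry_tail) (use I J elim in auto)
    also have "\<dots> \<le> (2 * real n) * (2 * real n) * (\<bar>A\<bar> * real n powr (- \<eta>)) ^ k"
    proof (intro mult_mono power_mono card_le_2n I J elim)
      have "A * real n powr - \<eta> \<le> \<bar>A\<bar> * real n powr - \<eta>" by (intro mult_right_mono) auto
      with elim show "?q \<le> \<bar>A\<bar> * real n powr (- \<eta>)" by linarith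
    qed (use elim in auto)
    also have "\<dots> = 4 * \<bar>A\<bar> ^ k * ((real n)\<^sup>2 * real n powr (- (\<eta> * real k)))"
      using elim by (simp add: power_mult_distrib powr_power power2_eq_square mult.commute[of \<eta>])
    also have "\<dots> \<le> 4 * \<bar>A\<bar> ^ k * ((real n)\<^sup>2 * real n powr (- 4))"
      using elim k by (intro mult_left_mono powr_mono) auto
    also have "(real n)\<^sup>2 * real n powr (- 4) = 1 / (real n)\<^sup>2"
      using elim by (simp add: powr_minus powr_numeral field_simps flip: power_add)
    finally show ?case by simp
  qed
qed

text \<open>Hoeffding's exponent is of the order \<open>(t n)\<^sup>2 / ((K n)\<^sup>2 * card (J n))\<close>, which is at least a constant times
  \<open>n powr (2 * u - 2 * a - s)\<close>.  A positive exponent beats the number of pairs and the factor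
  \<open>2 R + 1\<close>.\<close>

lemma pairs_rare:
  fixes I J :: "nat \<Rightarrow> nat set" and K \<rho> :: "nat \<Rightarrow> nat" and t :: "nat \<Rightarrow> real"
    and f :: "nat \<Rightarrow> nat \<Rightarrow> real"
  assumes entries: "rare (\<lambda>n X. \<exists>i\<in>I n. \<exists>j\<in>J n. K n < X i j)"
    and I: "\<And>n. I n \<subseteq> {..<m n + n}" "\<And>n i. i \<in> I n \<Longrightarrow> margin n \<delta> B C i = \<rho> n"
    and \<rho>: "\<And>n. real (\<rho> n) \<le> A * real n"
    and J: "\<And>n. J n \<subseteq> {..<m n + n}" "\<And>n. n \<ge> 1 \<Longrightarrow> J n \<noteq> {}" "\<And>n. n \<ge> 1 \<Longrightarrow> real (card (J n)) \<le> real n powr s"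
    and f: "\<And>c. (\<Sum>x\<le>c. f x (c - x)) = 0" "\<And>K x y. x + y \<le> 2 * K \<Longrightarrow> \<bar>f x y\<bar> \<le> 2 * real K"
    and K: "\<And>n. n \<ge> 1 \<Longrightarrow> K n \<ge> 1" "\<And>n. n \<ge> 1 \<Longrightarrow> real (K n) \<le> A1 * real n powr a"
    and t: "\<And>n. n \<ge> 1 \<Longrightarrow> t n \<ge> A2 * real n powr u" "A2 > 0" "A1 > 0"
    and exponent: "2 * u - 2 * a - s > 0"
  shows "rare (\<lambda>n. disagree f (t n) (I n) (J n))"
  unfolding rare_def
proof (rule summable_comparison_test_ev)
  let ?E = "\<lambda>n. sample_prob n (\<lambda>X. \<exists>i\<in>I n. \<exists>j\<in>J n. K n < X i j)"
  show "summable (\<lambda>n. 1 / (real n)\<^sup>2 + ?E n)"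
    using entries summable_inverse_square[of 1] by (simp add: rare_def summable_add)
  define \<gamma> where "\<gamma> = 2 * u - 2 * a - s"
  define c where "c = A2\<^sup>2 / (8 * A1\<^sup>2)"
  have "c > 0" "\<gamma> > 0" using t exponent by (auto simp: c_def \<gamma>_def)
  from gaussian_tail_eventually_small[OF this, of A]
  show "eventually (\<lambda>n. norm (sample_prob n (disagree f (t n) (I n) (J n)))
    \<le> 1 / (real n)\<^sup>2 + ?E n) sequentially"
    using eventually_ge_at_top[of 1]
  proof eventually_elim
    case (elim n)
    have n: "real n > 0" using elim by simp
    have tn: "t n > 0" using t(1)[of n] t(2) elim n by (smt (verit) mult_pos_pos powr_gt_zero)
    have Kn: "real (K n) > 0" using K(1)[of n] elim by simp
    have qn: "real (card (J n)) > 0"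
      using J(1,2)[of n] elim finite_subset[of "J n" "{..<m n + n}"] by (simp add: card_gt_0_iff)
    have "c * real n powr \<gamma> * (2 * (2 * real (K n))\<^sup>2 * card (J n))
      \<le> c * real n powr \<gamma> * (2 * (2 * (A1 * real n powr a))\<^sup>2 * real n powr s)"
      using \<open>c > 0\<close> K(2)[of n] J(3)[of n] elim n Kn
      by (intro mult_left_mono mult_mono power_mono) auto
    also have "\<dots> = (A2 * real n powr u)\<^sup>2"
    proof -
      have "real n powr \<gamma> * (real n powr a)\<^sup>2 * real n powr s = (real n powr u)\<^sup>2"
        using n by (simp add: \<gamma>_def powr_power flip: powr_add)
      then show ?thesis using t(3) by (simp add: c_def power_mult_distrib field_simps)
    qed
    also have "\<dots> \<le> (t n)\<^sup>2"
      using t(1)[of n] t(2) elim n by (intro power_mono) auto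
    finally have ex: "c * real n powr \<gamma> \<le> (t n)\<^sup>2 / (2 * (2 * real (K n))\<^sup>2 * card (J n))"
      using Kn qn by (simp add: field_simps)
    have "sample_prob n (disagree f (t n) (I n) (J n))
      \<le> (real (card (I n)))\<^sup>2 * (2 * (2 * real (\<rho> n) + 1) * exp (- ((t n)\<^sup>2 / (2 * (2 * real (K n))\<^sup>2 * card (J n))))) + ?E n"
      unfolding sample_prob_def
      by (rule all_pairs_concentration) (use I J f K elim tn Kn in auto)
    also have "\<dots> \<le> (2 * real n)\<^sup>2 * (2 * (2 * (A * real n) + 1) * exp (- (c * real n powr \<gamma>))) + ?E n"
      using \<rho>[of n] ex elim
      by (intro add_right_mono mult_mono power_mono card_le_2n I) auto
    also have "\<dots> \<le> 1 / (real n)\<^sup>2 + ?E n"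
      using elim(1) by (simp add: power_mult_distrib algebra_simps)
    finally show ?case by (simp add: sample_prob_nonneg)
  qed
qed

end

lemma near_mean:
  fixes V :: "'a \<Rightarrow> real"
  assumes "finite I" "i \<in> I" "e \<ge> 0" "\<And>i k. i \<in> I \<Longrightarrow> k \<in> I \<Longrightarrow> i \<noteq> k \<Longrightarrow> \<bar>V i - V k\<bar> \<le> e"
  shows "\<bar>V i - (\<Sum>k\<in>I. V k) / real (card I)\<bar> \<le> e"
proof -
  have c: "real (card I) > 0" using assms by (auto simp: card_gt_0_iff)
  have "\<bar>\<Sum>k\<in>I. V i - V k\<bar> \<le> (\<Sum>k\<in>I. e)"
    by (rule sum_abs[THEN order_trans], rule sum_mono) (use assms in \<open>metis abs_zero diff_self\<close>)
  then have "\<bar>real (card I) * V i - (\<Sum>k\<in>I. V k)\<bar> \<le> real (card I) * e"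
    by (simp add: sum_subtractf)
  also have "real (card I) * V i - (\<Sum>k\<in>I. V k) = real (card I) * (V i - (\<Sum>k\<in>I. V k) / real (card I))"
    using c by (simp add: field_simps)
  finally show ?thesis using c by (simp add: abs_mult)
qed

lemma block_sum_swap: "block_sum X I J = (\<Sum>j\<in>J. \<Sum>i\<in>I. X i j)"
  unfolding block_sum_def by (rule sum.swap)

lemma block_sum_flip: "block_sum (flip X) I J = block_sum X J I"
  unfolding block_sum_def flip_def by (rule sum.swap)

lemma npos_flip: "npos (flip X) I J = npos X J I"
  unfolding npos_def flip_def by (rule sum.swap)

text \<open>With \<open>u\<close> the mean entry and \<open>\<theta>\<close> the proportion of positive entries, the identity
  \<open>u * (1 - \<theta>) = \<theta>\<close> holds up to the errors of the two concentration statements.  It is kept in this form,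
  without dividing by \<open>1 + u\<close>, because \<open>u\<close> is large in the special block.\<close>

lemma block_density:
  fixes \<epsilon> :: real
  assumes fin: "finite I" "finite J" and ne: "card I \<ge> 1" "card J \<ge> 1" and \<epsilon>: "\<epsilon> \<ge> 0"
    and zb: "\<And>i k. i \<in> I \<Longrightarrow> k \<in> I \<Longrightarrow> i \<noteq> k \<Longrightarrow> \<bar>\<Sum>j\<in>J. zero_balance (X i j) (X k j)\<bar> \<le> \<epsilon> * card J"
    and col: "\<And>j l. j \<in> J \<Longrightarrow> l \<in> J \<Longrightarrow> j \<noteq> l \<Longrightarrow> \<bar>\<Sum>i\<in>I. real (X i j) - real (X i l)\<bar> \<le> \<epsilon> * card I"
  defines "u \<equiv> real (block_sum X I J) / (real (card I) * real (card J))"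
    and "\<theta> \<equiv> npos X I J / (real (card I) * real (card J))"
  shows "\<bar>\<theta> * (1 + u) - u\<bar> \<le> 2 * \<epsilon> + 1 / real (card I)"
proof -
  define p q P where "p = real (card I)" and "q = real (card J)" and "P = npos X I J"
  have pq: "p \<ge> 1" "q \<ge> 1" using ne by (auto simp: p_def q_def)
  have colmean: "\<bar>real (\<Sum>i\<in>I. X i j) - u * p\<bar> \<le> \<epsilon> * p" if "j \<in> J" for j
  proof -
    have "\<bar>real (\<Sum>i\<in>I. X i j) - (\<Sum>l\<in>J. real (\<Sum>i\<in>I. X i l)) / real (card J)\<bar> \<le> \<epsilon> * p"
      by (rule near_mean[OF fin(2) that]) (use col \<epsilon> in \<open>auto simp: p_def sum_subtractf\<close>)
    moreover have "(\<Sum>l\<in>J. real (\<Sum>i\<in>I. X i l)) / real (card J) = u * p"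
      using pq by (simp add: u_def block_sum_swap p_def q_def field_simps)
    ultimately show ?thesis by simp
  qed
  have "\<bar>u * p * (p * q - P) - (p - 1) * P\<bar> \<le> p\<^sup>2 * (\<epsilon> * q) + p * q * (\<epsilon> * p)"
    unfolding p_def q_def P_def
    by (rule block_positive_count[OF fin]) (use zb colmean \<epsilon> in \<open>auto simp: p_def\<close>)
  also have "u * p * (p * q - P) - (p - 1) * P = p\<^sup>2 * q * (u - \<theta> * (1 + u) + \<theta> / p)"
    using pq by (simp add: \<theta>_def P_def p_def q_def field_simps power2_eq_square)
  also have "p\<^sup>2 * (\<epsilon> * q) + p * q * (\<epsilon> * p) = p\<^sup>2 * q * (2 * \<epsilon>)" by (simp add: power2_eq_square)
  finally have "p\<^sup>2 * q * \<bar>u - \<theta> * (1 + u) + \<theta> / p\<bar> \<le> p\<^sup>2 * q * (2 * \<epsilon>)"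
    using pq by (simp add: abs_mult)
  then have 1: "\<bar>u - \<theta> * (1 + u) + \<theta> / p\<bar> \<le> 2 * \<epsilon>"
    using pq by (subst (asm) mult_le_cancel_left_pos) auto
  have "0 \<le> \<theta>" "\<theta> \<le> 1"
    using npos_nonneg[of X I J] npos_le[of X I J] pq by (auto simp: \<theta>_def p_def q_def divide_le_eq_1)
  then have "0 \<le> \<theta> / p" "\<theta> / p \<le> 1 / p" using pq by (auto simp: divide_right_mono)
  with 1 show ?thesis unfolding p_def by linarith
qed

text \<open>The probability that a geometric variable of mean \<open>u\<close> is positive.\<close>

definition geom_pos :: "real \<Rightarrow> real" where "geom_pos u = u / (1 + u)"

lemma geom_pos_bounds: "u \<ge> 0 \<Longrightarrow> 0 \<le> geom_pos u" "u \<ge> 0 \<Longrightarrow> geom_pos u < 1"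
  by (auto simp: geom_pos_def)

lemma geom_pos_mono: "0 \<le> u \<Longrightarrow> u \<le> v \<Longrightarrow> geom_pos u \<le> geom_pos v"
  by (simp add: geom_pos_def field_simps)

lemma geom_pos_strict_mono: "0 \<le> u \<Longrightarrow> u < v \<Longrightarrow> geom_pos u < geom_pos v"
  by (simp add: geom_pos_def field_simps)

lemma geom_pos_lipschitz: "0 \<le> u \<Longrightarrow> u \<le> v \<Longrightarrow> geom_pos v - geom_pos u \<le> v - u"
proof -
  assume uv: "0 \<le> u" "u \<le> v"
  have "geom_pos v - geom_pos u = (v - u) / ((1 + u) * (1 + v))" using uv by (simp add: geom_pos_def field_simps)
  also have "\<dots> \<le> (v - u) / 1"
  proof (intro divide_left_mono)
    show "1 \<le> (1 + u) * (1 + v)" using uv mult_mono[of 1 "1 + u" 1 "1 + v"] by simp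
  qed (use uv in auto)
  finally show ?thesis by simp
qed

lemma density_near_geom_pos:
  assumes "\<bar>\<theta> * (1 + u) - u\<bar> \<le> e" "u \<ge> 0"
  shows "\<bar>\<theta> - geom_pos u\<bar> \<le> e"
proof -
  have "\<theta> * (1 + u) - u = (\<theta> - geom_pos u) * (1 + u)" using assms(2) by (simp add: geom_pos_def field_simps)
  then have "\<bar>\<theta> - geom_pos u\<bar> * (1 + u) \<le> e" using assms by (simp add: abs_mult)
  moreover have "\<bar>\<theta> - geom_pos u\<bar> * 1 \<le> \<bar>\<theta> - geom_pos u\<bar> * (1 + u)" using assms(2) by (intro mult_left_mono) auto
  ultimately show ?thesis by simp
qed

context phase_parameters
begin

section \<open>Entries and row sums of the four blocks\<close>

text \<open>Entries in ordinary rows or columns are of order one, and the power \<open>n powr \<eta>\<close> is the room that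
  \<open>entries_rare\<close> needs.\<close>

definition ordinary_cap :: "real \<Rightarrow> nat \<Rightarrow> nat" where
  "ordinary_cap \<eta> n = 4 ^ nat \<lceil>4 / \<eta>\<rceil> * nat \<lceil>real n powr \<eta>\<rceil>"

lemma nat_ceiling_powr_bounds:
  assumes "n \<ge> 1" "\<eta> \<ge> 0"
  shows "1 \<le> nat \<lceil>real n powr \<eta>\<rceil>" "real n powr \<eta> \<le> real (nat \<lceil>real n powr \<eta>\<rceil>)"
    "real (nat \<lceil>real n powr \<eta>\<rceil>) \<le> 2 * real n powr \<eta>"
proof -
  have "1 \<le> real n powr \<eta>" using assms by (simp add: ge_one_powr_ge_zero)
  then show "1 \<le> nat \<lceil>real n powr \<eta>\<rceil>" "real n powr \<eta> \<le> real (nat \<lceil>real n powr \<eta>\<rceil>)"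
    "real (nat \<lceil>real n powr \<eta>\<rceil>) \<le> 2 * real n powr \<eta>"
    by linarith+
qed

lemma ordinary_cap_bounds:
  assumes "n \<ge> 1" "\<eta> \<ge> 0"
  shows "1 \<le> ordinary_cap \<eta> n" "real (ordinary_cap \<eta> n) \<le> (2 * 4 ^ nat \<lceil>4 / \<eta>\<rceil>) * real n powr \<eta>"
  using nat_ceiling_powr_bounds[OF assms] by (auto simp: ordinary_cap_def Suc_le_eq)

lemma ordinary_entries_rare:
  fixes M :: "nat \<Rightarrow> nat" and A \<eta> :: real
  assumes "\<eta> > 0" "\<And>n. J n \<subseteq> {..<m n + n}" "\<And>n j. j \<in> J n \<Longrightarrow> margin n \<delta> B C j \<le> M n"
    "\<And>n. real (M n) \<le> A * real n"
  shows "rare (\<lambda>n X. \<exists>i\<in>ordinary n. \<exists>j\<in>J n. ordinary_cap \<eta> n < X i j)"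
proof (rule rare_mono)
  show "rare (\<lambda>n X. \<exists>i\<in>ordinary n. \<exists>j\<in>J n. 4 ^ nat \<lceil>4 / \<eta>\<rceil> * nat \<lceil>real n powr \<eta>\<rceil> \<le> X i j)"
  proof (rule entries_rare[OF assms(1) block_sets(6) _ assms(2,3)])
    show "margin n \<delta> B C i = S n" if "i \<in> ordinary n" for n i using that by (rule margin_ordinary)
    show "eventually (\<lambda>n. 2 \<le> card (ordinary n)) sequentially"
      using eventually_ge_at_top[of 2] by (simp add: block_sets)
    show "eventually (\<lambda>n. 1 \<le> nat \<lceil>real n powr \<eta>\<rceil>) sequentially"
      using eventually_ge_at_top[of 1] by eventually_elim (use nat_ceiling_powr_bounds(1)[of _ \<eta>] assms(1) in auto)
    show "eventually (\<lambda>n. 2 * real (M n) / (real (nat \<lceil>real n powr \<eta>\<rceil>) * (real (card (ordinary n)) - 1)) \<le> (4 * A) * real n powr - \<eta>) sequentially"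
      using eventually_ge_at_top[of 2]
    proof eventually_elim
      case (elim n)
      have b: "real n powr \<eta> \<le> real (nat \<lceil>real n powr \<eta>\<rceil>)" using nat_ceiling_powr_bounds(2)[of n \<eta>] elim assms(1) by auto
      have "2 * real (M n) / (real (nat \<lceil>real n powr \<eta>\<rceil>) * (real (card (ordinary n)) - 1)) \<le> 2 * (A * real n) / (real n powr \<eta> * (real n / 2))"
      proof (rule frac_le)
        have "0 \<le> real (M n)" by simp
        with assms(4)[of n] show "0 \<le> 2 * (A * real n)" "2 * real (M n) \<le> 2 * (A * real n)" by linarith+
        show "0 < real n powr \<eta> * (real n / 2)" using elim by simp
        show "real n powr \<eta> * (real n / 2) \<le> real (nat \<lceil>real n powr \<eta>\<rceil>) * (real (card (ordinary n)) - 1)"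
          using elim b by (intro mult_mono) (auto simp: block_sets less_le_trans[OF _ powr_ge_zero])
      qed
      also have "\<dots> = (4 * A) * real n powr - \<eta>" using elim by (simp add: powr_minus field_simps)
      finally show ?case .
    qed
  qed
qed (auto simp: ordinary_cap_def intro!: always_eventually, meson less_imp_le_nat)

lemma ordinary_ordinary_entries_rare: "\<eta> > 0 \<Longrightarrow> rare (\<lambda>n X. \<exists>i\<in>ordinary n. \<exists>j\<in>ordinary n. ordinary_cap \<eta> n < X i j)"
  by (rule ordinary_entries_rare[where M = S and A = C]) (auto simp: block_sets margin_ordinary S_bounds)

lemma ordinary_special_entries_rare: "\<eta> > 0 \<Longrightarrow> rare (\<lambda>n X. \<exists>i\<in>ordinary n. \<exists>j\<in>special n. ordinary_cap \<eta> n < X i j)"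
  by (rule ordinary_entries_rare[where M = R and A = "B * C"]) (auto simp: block_sets margin_special R_bounds)

text \<open>There are few special rows, too few for a direct application of \<open>entry_tail\<close>; but after transposition
  the exchangeable rows are the ordinary ones.\<close>

lemma special_ordinary_entries_rare:
  assumes "\<eta> > 0"
  shows "rare (\<lambda>n X. \<exists>i\<in>special n. \<exists>j\<in>ordinary n. ordinary_cap \<eta> n < X i j)"
  by (rule rare_mono[OF rare_flip[OF ordinary_special_entries_rare[OF assms]]])
    (auto simp: flip_def intro!: always_eventually)

lemma ordinary_nonempty: "n \<ge> 1 \<Longrightarrow> ordinary n \<noteq> {}" by (auto simp: ordinary_def)

lemma special_nonempty: "n \<ge> 1 \<Longrightarrow> special n \<noteq> {}" using m_bounds(3)[of n] by (simp add: special_def lessThan_empty_iff)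

lemma abs_difference_le: "x + y \<le> 2 * K \<Longrightarrow> \<bar>real x - real y\<bar> \<le> 2 * real K" by linarith

lemma ordinary_ordinary_row_sums_agree:
  assumes "\<epsilon> > 0"
  shows "rare (\<lambda>n. disagree difference (\<epsilon> * real n) (ordinary n) (ordinary n))"
  by (rule pairs_rare[where f = "\<lambda>x y. real x - real y" and s = 1 and u = 1 and a = "1/4" and K = "ordinary_cap (1/4)",
        OF ordinary_ordinary_entries_rare block_sets(6) margin_ordinary S_bounds(1) block_sets(6) ordinary_nonempty _
          difference_fibre_sum abs_difference_le ordinary_cap_bounds])
    (use assms in \<open>auto simp: block_sets\<close>)

lemma ordinary_ordinary_zero_balance:
  assumes "\<epsilon> > 0"
  shows "rare (\<lambda>n. disagree zero_balance (\<epsilon> * real n) (ordinary n) (ordinary n))"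
  by (rule pairs_rare[where f = zero_balance and s = 1 and u = 1 and a = "1/4" and K = "ordinary_cap (1/4)",
        OF ordinary_ordinary_entries_rare block_sets(6) margin_ordinary S_bounds(1) block_sets(6) ordinary_nonempty _
          zero_balance_fibre_sum abs_zero_balance_le ordinary_cap_bounds])
    (use assms in \<open>auto simp: block_sets\<close>)

lemma special_ordinary_row_sums_agree:
  assumes "\<epsilon> > 0"
  shows "rare (\<lambda>n. disagree difference (\<epsilon> * real n) (special n) (ordinary n))"
  by (rule pairs_rare[where f = "\<lambda>x y. real x - real y" and s = 1 and u = 1 and a = "1/4" and K = "ordinary_cap (1/4)",
        OF special_ordinary_entries_rare block_sets(5) margin_special R_bounds(1) block_sets(6) ordinary_nonempty _
          difference_fibre_sum abs_difference_le ordinary_cap_bounds])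
    (use assms in \<open>auto simp: block_sets\<close>)

lemma ordinary_special_zero_balance:
  assumes "\<epsilon> > 0" "\<delta> > 0"
  shows "rare (\<lambda>n. disagree zero_balance (\<epsilon> * real (m n)) (ordinary n) (special n))"
proof (rule pairs_rare[where f = zero_balance and s = \<delta> and u = \<delta> and a = "\<delta>/4" and K = "ordinary_cap (\<delta>/4)"
        and ?A2.0 = "\<epsilon>/2",
        OF ordinary_special_entries_rare block_sets(6) margin_ordinary S_bounds(1) block_sets(5) special_nonempty _
          zero_balance_fibre_sum abs_zero_balance_le ordinary_cap_bounds])
  show "\<epsilon> / 2 * real n powr \<delta> \<le> \<epsilon> * real (m n)" if "n \<ge> 1" for n
    using mult_left_mono[OF m_bounds(1)[OF that], of \<epsilon>] assms by simp
qed (use assms m_bounds in \<open>auto simp: block_sets\<close>)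

text \<open>The special block has \<open>m n\<close> rows of mass up to \<open>B * C * n\<close>, so its entries may be of the order
  \<open>n / m n\<close>, which is \<open>n powr (1 - \<delta>)\<close>.\<close>

definition special_cap :: "real \<Rightarrow> nat \<Rightarrow> nat" where
  "special_cap \<eta> n = 4 ^ nat \<lceil>4 / \<eta>\<rceil> * nat \<lceil>real n powr (1 - \<delta> + \<eta>)\<rceil>"

lemma special_cap_bounds:
  assumes "n \<ge> 1" "\<eta> \<ge> 0"
  shows "1 \<le> special_cap \<eta> n" "real (special_cap \<eta> n) \<le> (2 * 4 ^ nat \<lceil>4 / \<eta>\<rceil>) * real n powr (1 - \<delta> + \<eta>)"
proof -
  have "1 - \<delta> + \<eta> \<ge> 0" using assms \<delta>_less by simp
  from nat_ceiling_powr_bounds[OF assms(1) this]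
  show "1 \<le> special_cap \<eta> n" "real (special_cap \<eta> n) \<le> (2 * 4 ^ nat \<lceil>4 / \<eta>\<rceil>) * real n powr (1 - \<delta> + \<eta>)"
    by (auto simp: special_cap_def Suc_le_eq)
qed

lemma m_at_top:
  assumes "\<delta> > 0"
  shows "filterlim (\<lambda>n. real (m n)) at_top sequentially"
proof (rule filterlim_at_top_mono)
  show "filterlim (\<lambda>n::nat. real n powr \<delta> / 2) at_top sequentially" using assms by real_asymp
  show "eventually (\<lambda>n. real n powr \<delta> / 2 \<le> real (m n)) sequentially"
    using eventually_ge_at_top[of 1] by eventually_elim (rule m_bounds)
qed

lemma m_over_n_tendsto: "(\<lambda>n. real (m n) / real n) \<longlonglongrightarrow> 0"
proof (rule tendsto_sandwich[of "\<lambda>_. 0"])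
  have "\<delta> - 1 < 0" using \<delta>_less by simp
  then show "(\<lambda>n::nat. real n powr (\<delta> - 1)) \<longlonglongrightarrow> 0" by real_asymp
  show "eventually (\<lambda>n. real (m n) / real n \<le> real n powr (\<delta> - 1)) sequentially"
    using eventually_ge_at_top[of 1]
  proof eventually_elim
    case (elim n)
    then have "real n powr (\<delta> - 1) = real n powr \<delta> / real n" by (simp add: powr_diff)
    then show ?case using m_bounds(2)[OF elim] by (simp add: divide_right_mono)
  qed
qed auto

lemma special_special_entries_rare:
  assumes "\<eta> > 0" "\<delta> > 0"
  shows "rare (\<lambda>n X. \<exists>i\<in>special n. \<exists>j\<in>special n. special_cap \<eta> n < X i j)"
proof (rule rare_mono)
  show "rare (\<lambda>n X. \<exists>i\<in>special n. \<exists>j\<in>special n. 4 ^ nat \<lceil>4 / \<eta>\<rceil> * nat \<lceil>real n powr (1 - \<delta> + \<eta>)\<rceil> \<le> X i j)"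
  proof (rule entries_rare[OF assms(1) block_sets(5) _ block_sets(5)])
    have e: "1 - \<delta> + \<eta> \<ge> 0" using assms \<delta>_less by simp
    show "margin n \<delta> B C i = R n" if "i \<in> special n" for n i using that by (rule margin_special)
    show "margin n \<delta> B C i \<le> R n" if "i \<in> special n" for n i using that by (simp add: margin_special)
    have large: "eventually (\<lambda>n. real (m n) \<ge> 2) sequentially"
      using m_at_top[OF assms(2)] unfolding filterlim_at_top by blast
    then show "eventually (\<lambda>n. 2 \<le> card (special n)) sequentially"
      by eventually_elim (simp add: block_sets)
    show "eventually (\<lambda>n. 1 \<le> nat \<lceil>real n powr (1 - \<delta> + \<eta>)\<rceil>) sequentially"
      using eventually_ge_at_top[of 1] by eventually_elim (use nat_ceiling_powr_bounds(1)[OF _ e] in auto)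
    show "eventually (\<lambda>n. 2 * real (R n) / (real (nat \<lceil>real n powr (1 - \<delta> + \<eta>)\<rceil>) * (real (card (special n)) - 1))
        \<le> (8 * (B * C)) * real n powr - \<eta>) sequentially"
      using eventually_ge_at_top[of 1] large
    proof eventually_elim
      case (elim n)
      have b: "real n powr (1 - \<delta> + \<eta>) \<le> real (nat \<lceil>real n powr (1 - \<delta> + \<eta>)\<rceil>)" using nat_ceiling_powr_bounds(2)[OF _ e] elim by auto
      have m: "real n powr \<delta> / 4 \<le> real (m n) - 1" using m_bounds(1)[OF elim(1)] elim(2) by linarith
      have "2 * real (R n) / (real (nat \<lceil>real n powr (1 - \<delta> + \<eta>)\<rceil>) * (real (card (special n)) - 1))
        \<le> 2 * (B * C * real n) / (real n powr (1 - \<delta> + \<eta>) * (real n powr \<delta> / 4))"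
        using elim b m R_bounds(1)[of n] B_pos C_pos
        by (intro frac_le mult_left_mono mult_mono mult_pos_pos)
          (auto simp: block_sets less_le_trans[OF _ powr_ge_zero])
      also have "\<dots> = (8 * (B * C)) * (real n powr 1 / (real n powr (1 - \<delta> + \<eta>) * real n powr \<delta>))"
        using elim by simp
      also have "real n powr 1 / (real n powr (1 - \<delta> + \<eta>) * real n powr \<delta>) = real n powr - \<eta>"
        using elim by (simp add: powr_minus powr_add divide_simps del: powr_one)
          (simp flip: powr_add)
      finally show ?case .
    qed
  qed
qed (auto simp: special_cap_def intro!: always_eventually, meson less_imp_le_nat)

lemma special_special_zero_balance:
  assumes "\<epsilon> > 0" "\<delta> > 0"
  shows "rare (\<lambda>n. disagree zero_balance (\<epsilon> * real n) (special n) (special n))"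
  by (rule pairs_rare[where f = zero_balance and s = \<delta> and u = 1 and a = "1 - \<delta> + \<delta>/4" and K = "special_cap (\<delta>/4)",
        OF special_special_entries_rare block_sets(5) margin_special R_bounds(1) block_sets(5) special_nonempty _
          zero_balance_fibre_sum abs_zero_balance_le special_cap_bounds])
    (use assms m_bounds in \<open>auto simp: block_sets field_simps\<close>)

end

context phase_parameters
begin

section \<open>Densities outside the exceptional event\<close>

text \<open>Everything that has to hold outside a rare event.  The statistics of rows and of columns are both needed,
  as \<open>block_density\<close> uses pairs of rows for \<open>zero_balance\<close> and pairs of columns for the sums.\<close>

definition bad :: "real \<Rightarrow> nat \<Rightarrow> (nat \<Rightarrow> nat \<Rightarrow> nat) \<Rightarrow> bool" where
  "bad \<epsilon> n X \<longleftrightarrow>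
     disagree difference (\<epsilon> * real n) (special n) (ordinary n) X \<or>
     disagree difference (\<epsilon> * real n) (special n) (ordinary n) (flip X) \<or>
     disagree difference (\<epsilon> * real n) (ordinary n) (ordinary n) (flip X) \<or>
     disagree zero_balance (\<epsilon> * real n) (ordinary n) (ordinary n) X \<or>
     disagree zero_balance (\<epsilon> * real (m n)) (ordinary n) (special n) X \<or>
     disagree zero_balance (\<epsilon> * real (m n)) (ordinary n) (special n) (flip X) \<or>
     disagree zero_balance (\<epsilon> * real n) (special n) (special n) X"

lemma bad_rare:
  assumes "\<epsilon> > 0" "\<delta> > 0"
  shows "rare (bad \<epsilon>)"
  unfolding bad_def[abs_def]
  by (intro rare_disj special_ordinary_row_sums_agree rare_flip[OF special_ordinary_row_sums_agree]
      rare_flip[OF ordinary_ordinary_row_sums_agree] ordinary_ordinary_zero_balance ordinary_special_zero_balance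
      rare_flip[OF ordinary_special_zero_balance] special_special_zero_balance assms)

lemma row_split:
  assumes "X \<in> samples n"
  shows "i \<in> special n \<Longrightarrow> (\<Sum>j\<in>special n. X i j) + (\<Sum>j\<in>ordinary n. X i j) = R n"
    and "i \<in> ordinary n \<Longrightarrow> (\<Sum>j\<in>special n. X i j) + (\<Sum>j\<in>ordinary n. X i j) = S n"
    and "j \<in> special n \<Longrightarrow> (\<Sum>i\<in>special n. X i j) + (\<Sum>i\<in>ordinary n. X i j) = R n"
    and "j \<in> ordinary n \<Longrightarrow> (\<Sum>i\<in>special n. X i j) + (\<Sum>i\<in>ordinary n. X i j) = S n"
proof -
  have split: "(\<Sum>j<m n + n. f j) = (\<Sum>j\<in>special n. f j) + (\<Sum>j\<in>ordinary n. f j)" for f :: "nat \<Rightarrow> nat"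
    unfolding block_sets(8) by (rule sum.union_disjoint) (auto simp: block_sets)
  have lt: "i < m n + n" if "i \<in> special n \<or> i \<in> ordinary n" for i
    using that block_sets(5,6)[of n] by blast
  show "i \<in> special n \<Longrightarrow> (\<Sum>j\<in>special n. X i j) + (\<Sum>j\<in>ordinary n. X i j) = R n"
    "i \<in> ordinary n \<Longrightarrow> (\<Sum>j\<in>special n. X i j) + (\<Sum>j\<in>ordinary n. X i j) = S n"
    "j \<in> special n \<Longrightarrow> (\<Sum>i\<in>special n. X i j) + (\<Sum>i\<in>ordinary n. X i j) = R n"
    "j \<in> ordinary n \<Longrightarrow> (\<Sum>i\<in>special n. X i j) + (\<Sum>i\<in>ordinary n. X i j) = S n"
    using assms lt by (auto simp: samples_def tables_def margin_special margin_ordinary simp flip: split)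
qed

definition mixed_total :: "nat \<Rightarrow> (nat \<Rightarrow> nat \<Rightarrow> nat) \<Rightarrow> nat" where "mixed_total n X = block_sum X (special n) (ordinary n)"
definition special_total :: "nat \<Rightarrow> (nat \<Rightarrow> nat \<Rightarrow> nat) \<Rightarrow> nat" where "special_total n X = block_sum X (special n) (special n)"

lemma block_totals:
  assumes "X \<in> samples n"
  shows "special_total n X + mixed_total n X = m n * R n"
    and "block_sum X (ordinary n) (special n) = mixed_total n X"
    and "mixed_total n X + block_sum X (ordinary n) (ordinary n) = n * S n"
proof -
  show 1: "special_total n X + mixed_total n X = m n * R n"
    using row_split(1)[OF assms]
    by (simp add: special_total_def mixed_total_def block_sum_def block_sets flip: sum.distrib)
  have 2: "special_total n X + block_sum X (ordinary n) (special n) = m n * R n"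
    using row_split(3)[OF assms]
    by (simp add: special_total_def block_sum_swap block_sets flip: sum.distrib)
  from 1 2 show 3: "block_sum X (ordinary n) (special n) = mixed_total n X" by simp
  have "block_sum X (ordinary n) (special n) + block_sum X (ordinary n) (ordinary n) = n * S n"
    using row_split(2)[OF assms] by (simp add: block_sum_def block_sets flip: sum.distrib)
  with 3 show "mixed_total n X + block_sum X (ordinary n) (ordinary n) = n * S n" by simp
qed

text \<open>Bounds the distance of the mean of the ordinary block from \<open>C\<close>: the first part is the mass that the
  special rows may take from the ordinary columns, the second the rounding of the margins.\<close>

definition loss :: "nat \<Rightarrow> real" where "loss n = B * C * (real (m n) / real n) + 1 / real n"

lemma loss_tendsto: "loss \<longlonglongrightarrow> 0"
proof -
  have "(\<lambda>n. B * C * (real (m n) / real n) + 1 / real n) \<longlonglongrightarrow> B * C * 0 + 0"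
    by (intro tendsto_add tendsto_mult tendsto_const m_over_n_tendsto lim_1_over_n)
  then show ?thesis by (simp add: loss_def[abs_def])
qed

lemma ordinary_block_mean:
  assumes "X \<in> samples n" "n \<ge> 1"
  shows "\<bar>real (block_sum X (ordinary n) (ordinary n)) / (real n * real n) - C\<bar> \<le> loss n"
proof -
  have W: "real (mixed_total n X) \<le> real (m n) * (B * C * real n)"
  proof -
    have "real (mixed_total n X) \<le> real (m n * R n)" using block_totals(1)[OF assms(1)] by linarith
    also have "\<dots> \<le> real (m n) * (B * C * real n)"
      using R_bounds(1)[of n] by (simp add: mult_left_mono)
    finally show ?thesis .
  qed
  have O: "real (block_sum X (ordinary n) (ordinary n)) = real n * real (S n) - real (mixed_total n X)"
    using block_totals(3)[OF assms(1)] by (simp flip: of_nat_mult add: of_nat_diff algebra_simps)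
  have "real n * real (S n) \<le> real n * (C * real n)" "real n * (C * real n - 1) \<le> real n * real (S n)"
    using S_bounds[of n] by (auto intro: mult_left_mono)
  with O W have "\<bar>real (block_sum X (ordinary n) (ordinary n)) - C * (real n * real n)\<bar> \<le> real (m n) * (B * C * real n) + real n"
    by (auto simp: algebra_simps abs_le_iff)
  also have "\<dots> = loss n * (real n * real n)"
    using assms(2) by (simp add: loss_def field_simps)
  finally have "\<bar>real (block_sum X (ordinary n) (ordinary n)) - C * (real n * real n)\<bar> / (real n * real n) \<le> loss n"
    using assms(2) by (simp add: divide_le_eq)
  moreover have "\<bar>real (block_sum X (ordinary n) (ordinary n)) - C * (real n * real n)\<bar> / (real n * real n)
    = \<bar>real (block_sum X (ordinary n) (ordinary n)) / (real n * real n) - C\<bar>"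
    using assms(2) by (simp add: diff_divide_distrib flip: abs_divide[of _ "real n * real n", unfolded abs_mult abs_of_nat])
  ultimately show ?thesis by simp
qed

definition pos_density :: "nat set \<Rightarrow> nat set \<Rightarrow> (nat \<Rightarrow> nat \<Rightarrow> nat) \<Rightarrow> real" where
  "pos_density I J X = npos X I J / (real (card I) * real (card J))"

lemma pos_density_bounds:
  assumes "card I \<ge> 1" "card J \<ge> 1"
  shows "0 \<le> pos_density I J X" "pos_density I J X \<le> 1"
  using npos_nonneg[of X I J] npos_le[of X I J] assms
  by (auto simp: pos_density_def divide_le_eq)

text \<open>Three blocks have entries of order one, and their densities follow from their means.  The special block only
  has to be almost full; its mean exceeds any constant when its mass \<open>special_total n X\<close> is of order \<open>m n * n\<close>, and the last bound is then useful.\<close>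

lemma good_densities:
  assumes X: "X \<in> samples n" and n: "n \<ge> 1" and \<epsilon>: "\<epsilon> > 0" and good: "\<not> bad \<epsilon> n X"
  defines "u \<equiv> real (mixed_total n X) / (real (m n) * real n)"
  shows "\<bar>pos_density (ordinary n) (ordinary n) X - geom_pos C\<bar> \<le> 2 * \<epsilon> + 2 * loss n"
    and "\<bar>pos_density (ordinary n) (special n) X - geom_pos u\<bar> \<le> 2 * \<epsilon> + loss n"
    and "\<bar>pos_density (special n) (ordinary n) X - geom_pos u\<bar> \<le> 2 * \<epsilon> + loss n"
    and "(1 - pos_density (special n) (special n) X) * real (special_total n X)
      \<le> real (m n) * (2 * real (m n) + 2 * \<epsilon> * real n)"
proof -
  have m: "1 \<le> m n" using m_bounds(3)[OF n] .
  have card: "card (special n) = m n" "card (ordinary n) = n" by (simp_all add: block_sets)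
  have inv_n: "1 / real n \<le> loss n" using B_pos C_pos by (simp add: loss_def)
  have u0: "0 \<le> u" by (simp add: u_def)
  define w where "w = real (block_sum X (ordinary n) (ordinary n)) / (real n * real n)"
  have w0: "0 \<le> w" by (simp add: w_def)
  have good': "\<not> disagree difference (\<epsilon> * real n) (special n) (ordinary n) X"
     "\<not> disagree difference (\<epsilon> * real n) (special n) (ordinary n) (flip X)"
     "\<not> disagree difference (\<epsilon> * real n) (ordinary n) (ordinary n) (flip X)"
     "\<not> disagree zero_balance (\<epsilon> * real n) (ordinary n) (ordinary n) X"
     "\<not> disagree zero_balance (\<epsilon> * real (m n)) (ordinary n) (special n) X"
     "\<not> disagree zero_balance (\<epsilon> * real (m n)) (ordinary n) (special n) (flip X)"
     "\<not> disagree zero_balance (\<epsilon> * real n) (special n) (special n) X"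
    using good unfolding bad_def by blast+
  note near = good'[THEN not_disagreeD, unfolded flip_def]
  have dod: "\<bar>pos_density (ordinary n) (ordinary n) X * (1 + w) - w\<bar> \<le> 2 * \<epsilon> + 1 / real n"
    using block_density[of "ordinary n" "ordinary n" \<epsilon> X] n \<epsilon> near(3,4)
    unfolding pos_density_def w_def by (simp add: block_sets)
  have "\<bar>pos_density (ordinary n) (ordinary n) X - geom_pos w\<bar> \<le> 2 * \<epsilon> + 1 / real n"
    by (rule density_near_geom_pos[OF dod w0])
  moreover have "\<bar>geom_pos w - geom_pos C\<bar> \<le> \<bar>w - C\<bar>"
    using geom_pos_lipschitz[of w C] geom_pos_lipschitz[of C w] geom_pos_mono[of w C] geom_pos_mono[of C w] w0 C_pos
    by (cases "w \<le> C") auto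
  moreover have "\<bar>w - C\<bar> \<le> loss n" unfolding w_def by (rule ordinary_block_mean[OF X n])
  ultimately show "\<bar>pos_density (ordinary n) (ordinary n) X - geom_pos C\<bar> \<le> 2 * \<epsilon> + 2 * loss n"
    using inv_n by linarith
  have "\<bar>pos_density (ordinary n) (special n) X * (1 + u) - u\<bar> \<le> 2 * \<epsilon> + 1 / real n"
    using block_density[of "ordinary n" "special n" \<epsilon> X] n m \<epsilon> near(2,5)
    unfolding pos_density_def u_def block_totals(2)[OF X, symmetric]
    by (simp add: block_sets mult.commute[of "real (m n)"])
  from density_near_geom_pos[OF this u0] inv_n
  show "\<bar>pos_density (ordinary n) (special n) X - geom_pos u\<bar> \<le> 2 * \<epsilon> + loss n" by linarith
  have "\<bar>pos_density (special n) (ordinary n) X * (1 + u) - u\<bar> \<le> 2 * \<epsilon> + 1 / real n"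
    using block_density[of "ordinary n" "special n" \<epsilon> "flip X"] n m \<epsilon> near(1,6)
    unfolding pos_density_def u_def mixed_total_def npos_flip block_sum_flip
    by (simp add: block_sets flip_def mult.commute[of "real (m n)"])
  from density_near_geom_pos[OF this u0] inv_n
  show "\<bar>pos_density (special n) (ordinary n) X - geom_pos u\<bar> \<le> 2 * \<epsilon> + loss n" by linarith
  \<comment> \<open>the deviations \<open>\<epsilon> * n\<close> of the special block, relative to its side length\<close>
  define e where "e = \<epsilon> * real n / real (m n)"
  define v where "v = real (special_total n X) / (real (m n) * real (m n))"
  define \<theta> where "\<theta> = pos_density (special n) (special n) X"
  have e: "e \<ge> 0" "e * real (m n) = \<epsilon> * real n" using \<epsilon> m by (auto simp: e_def)
  have col: "\<bar>\<Sum>i\<in>special n. real (X i j) - real (X i l)\<bar> \<le> e * real (m n)"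
    if "j \<in> special n" "l \<in> special n" "j \<noteq> l" for j l
  proof -
    have "real (\<Sum>i\<in>special n. X i j) + real (\<Sum>i\<in>ordinary n. X i j) = real (\<Sum>i\<in>special n. X i l) + real (\<Sum>i\<in>ordinary n. X i l)"
      using row_split(3)[OF X that(1)] row_split(3)[OF X that(2)] by (simp only: flip: of_nat_add)
    then have "(\<Sum>i\<in>special n. real (X i j) - real (X i l)) = - (\<Sum>i\<in>ordinary n. real (X i j) - real (X i l))"
      by (simp add: sum_subtractf)
    moreover have "\<bar>\<Sum>i\<in>ordinary n. real (X i j) - real (X i l)\<bar> \<le> \<epsilon> * real n"
      by (rule near(2)[OF that])
    ultimately show ?thesis unfolding e by simp
  qed
  have "\<bar>\<theta> * (1 + v) - v\<bar> \<le> 2 * e + 1 / real (m n)"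
    using block_density[of "special n" "special n" e X] m e(1) near(7)[folded e(2)] col
    unfolding \<theta>_def pos_density_def v_def special_total_def by (simp add: block_sets)
  moreover have \<theta>: "0 \<le> \<theta>" "\<theta> \<le> 1"
    unfolding \<theta>_def using pos_density_bounds[of "special n" "special n"] m by (auto simp: card)
  ultimately have "(1 - \<theta>) * v \<le> 1 + 2 * e + 1 / real (m n)"
    by (simp add: algebra_simps abs_le_iff)
  also have "\<dots> \<le> 2 + 2 * e" using m by simp
  finally have "(1 - \<theta>) * v * (real (m n) * real (m n)) \<le> (2 + 2 * e) * (real (m n) * real (m n))"
    by (intro mult_right_mono) auto
  also have "(2 + 2 * e) * (real (m n) * real (m n)) = real (m n) * (2 * real (m n) + 2 * (e * real (m n)))"
    by (simp add: algebra_simps)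
  also have "(1 - \<theta>) * v * (real (m n) * real (m n)) = (1 - \<theta>) * real (special_total n X)"
    using m by (simp add: v_def)
  finally show "(1 - pos_density (special n) (special n) X) * real (special_total n X) \<le> real (m n) * (2 * real (m n) + 2 * \<epsilon> * real n)"
    unfolding e \<theta>_def by (simp add: mult.assoc)
qed

section \<open>Balance of the switching rates\<close>

text \<open>The fraction of the minors along which a unit can be moved out of the special block; \<open>up_rate\<close> is the
  fraction along which one can be moved in.\<close>

definition down_rate :: "nat \<Rightarrow> (nat \<Rightarrow> nat \<Rightarrow> nat) \<Rightarrow> real" where
  "down_rate n X = pos_density (special n) (special n) X * pos_density (ordinary n) (ordinary n) X"
definition up_rate :: "nat \<Rightarrow> (nat \<Rightarrow> nat \<Rightarrow> nat) \<Rightarrow> real" where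
  "up_rate n X = pos_density (special n) (ordinary n) X * pos_density (ordinary n) (special n) X"

lemma rate_bounds:
  assumes "n \<ge> 1"
  shows "0 \<le> down_rate n X" "down_rate n X \<le> 1" "0 \<le> up_rate n X" "up_rate n X \<le> 1"
proof -
  have c: "card (special n) \<ge> 1" "card (ordinary n) \<ge> 1" using m_bounds(3)[OF assms] assms by (auto simp: block_sets)
  note d = pos_density_bounds[OF c(1) c(1), of X] pos_density_bounds[OF c(1) c(2), of X]
    pos_density_bounds[OF c(2) c(1), of X] pos_density_bounds[OF c(2) c(2), of X]
  show "0 \<le> down_rate n X" "down_rate n X \<le> 1" "0 \<le> up_rate n X" "up_rate n X \<le> 1"
    unfolding down_rate_def up_rate_def using d by (auto intro: mult_le_one)
qed

lemma special_total_balance: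
  fixes h :: "nat \<Rightarrow> real"
  shows "(\<Sum>X\<in>samples n. down_rate n X * h (special_total n X)) = (\<Sum>X\<in>samples n. up_rate n X * h (special_total n X + 1))"
proof -
  let ?c = "1 / (real (m n) * real (m n) * (real n * real n))"
  have "(\<Sum>X\<in>samples n. down_rate n X * h (special_total n X))
    = ?c * (\<Sum>X\<in>samples n. npos X (special n) (special n) * npos X (ordinary n) (ordinary n) * h (special_total n X))"
    unfolding sum_distrib_left by (rule sum.cong) (auto simp: down_rate_def pos_density_def block_sets)
  also have "\<dots> = ?c * (\<Sum>X\<in>samples n. npos X (special n) (ordinary n) * npos X (ordinary n) (special n) * h (special_total n X + 1))"
    unfolding samples_def special_total_def special_def ordinary_def by (simp only: switching_balance)
  also have "\<dots> = (\<Sum>X\<in>samples n. up_rate n X * h (special_total n X + 1))"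
    unfolding sum_distrib_left by (rule sum.cong) (auto simp: up_rate_def pos_density_def block_sets)
  finally show ?thesis .
qed

text \<open>The total \<open>special_total n X + mixed_total n X\<close> is constant, so the balance can be read in the other direction.\<close>

lemma mixed_total_balance:
  fixes h :: "nat \<Rightarrow> real"
  shows "(\<Sum>X\<in>samples n. up_rate n X * h (mixed_total n X)) = (\<Sum>X\<in>samples n. down_rate n X * h (mixed_total n X + 1))"
proof -
  let ?M = "m n * R n"
  define h' where "h' t = h (?M - t + 1)" for t
  have TW: "special_total n X = ?M - mixed_total n X" "mixed_total n X \<le> ?M" if "X \<in> samples n" for X
    using block_totals(1)[OF that] by auto
  have "(\<Sum>X\<in>samples n. down_rate n X * h (mixed_total n X + 1)) = (\<Sum>X\<in>samples n. down_rate n X * h' (special_total n X))"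
    by (rule sum.cong) (auto simp: h'_def TW)
  also have "\<dots> = (\<Sum>X\<in>samples n. up_rate n X * h' (special_total n X + 1))" by (rule special_total_balance)
  also have "\<dots> = (\<Sum>X\<in>samples n. up_rate n X * h (mixed_total n X))"
  proof (rule sum.cong[OF refl])
    fix X assume X: "X \<in> samples n"
    show "up_rate n X * h' (special_total n X + 1) = up_rate n X * h (mixed_total n X)"
    proof (cases "mixed_total n X = 0")
      case True
      then have "npos X (special n) (ordinary n) = 0"
        by (simp add: mixed_total_def block_sum_def npos_def block_sets)
      then show ?thesis by (simp add: up_rate_def pos_density_def)
    next
      case False
      then have "?M - (special_total n X + 1) + 1 = mixed_total n X" using TW[OF X] by simp
      then show ?thesis by (simp add: h'_def)
    qed
  qed
  finally show ?thesis by simp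
qed

end

section \<open>The mass of the special rows\<close>

text \<open>With \<open>s = sqrt (1 + 1 / C)\<close> the critical mean is \<open>1 / (s - 1)\<close>, and both sides are \<open>1 / s\<^sup>2\<close>.\<close>

lemma geom_pos_critical:
  assumes "C > 0"
  shows "(geom_pos (critical_B C * C))\<^sup>2 = geom_pos C" "critical_B C * C > 0"
proof -
  define s where "s = sqrt (1 + 1 / C)"
  have s2: "s\<^sup>2 = 1 + 1 / C" using assms by (simp add: s_def add_nonneg_nonneg)
  have s: "s > 1" using assms by (simp add: s_def)
  have C: "C = 1 / (s\<^sup>2 - 1)" using assms by (simp add: s2)
  have "critical_B C * C = (1 + s) / (s\<^sup>2 - 1)" by (subst C) (simp add: critical_B_def s_def[symmetric])
  also have "\<dots> = 1 / (s - 1)"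
  proof -
    have "s\<^sup>2 - 1 = (1 + s) * (s - 1)" by (simp add: algebra_simps power2_eq_square)
    then show ?thesis using s by simp
  qed
  finally have u: "critical_B C * C = 1 / (s - 1)" .
  have "geom_pos (critical_B C * C) = 1 / s" using s unfolding u geom_pos_def by (simp add: field_simps)
  moreover have "geom_pos C = 1 / s\<^sup>2" using assms by (simp add: geom_pos_def s2 field_simps)
  ultimately show "(geom_pos (critical_B C * C))\<^sup>2 = geom_pos C" by (simp add: power_divide)
  show "critical_B C * C > 0" unfolding u using s by simp
qed

context phase_parameters
begin

lemma eventually_loss_le: "\<epsilon> > 0 \<Longrightarrow> eventually (\<lambda>n. loss n \<le> \<epsilon>) sequentially"
  using order_tendstoD(2)[OF loss_tendsto, of \<epsilon>] by (auto elim: eventually_mono)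

lemma eventually_m_over_n_le: "\<epsilon> > 0 \<Longrightarrow> eventually (\<lambda>n. real (m n) / real n \<le> \<epsilon>) sequentially"
  using order_tendstoD(2)[OF m_over_n_tendsto, of \<epsilon>] by (auto elim: eventually_mono)

text \<open>As long as the special rows put less than \<open>a < B * C\<close> per entry on the ordinary columns, the special block
  holds mass of order \<open>m n * n\<close> and is almost full.  The rate down is then near \<open>geom_pos C\<close>, the rate up at
  most about \<open>(geom_pos a)\<^sup>2\<close>.\<close>

lemma special_total_drift:
  assumes a: "0 \<le> a" "a < B * C" and sub: "(geom_pos a)\<^sup>2 < geom_pos C"
  obtains \<epsilon> g where "\<epsilon> > 0" "0 < g" "g \<le> 1"
    "eventually (\<lambda>n. \<forall>X\<in>samples n. \<not> bad \<epsilon> n X \<longrightarrow> real (mixed_total n X) \<le> a * (real (m n) * real n)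
       \<longrightarrow> up_rate n X \<le> down_rate n X - g) sequentially"
proof -
  \<comment> \<open>the special block keeps a mass of at least \<open>d * n\<close> per row\<close>
  define d where "d = (B * C - a) / 2"
  define g where "g = (geom_pos C - (geom_pos a)\<^sup>2) / 2"
  have g2: "2 * g = geom_pos C - (geom_pos a)\<^sup>2" by (simp add: g_def)
  \<comment> \<open>the two rates lose at most \<open>15 * \<epsilon>\<close> and \<open>4 * \<epsilon> + 3 * \<epsilon> / d\<close>\<close>
  define \<epsilon> where "\<epsilon> = min 1 (g / (19 + 3 / d))"
  have d: "d > 0" using a by (simp add: d_def)
  have oa: "0 \<le> geom_pos a" "geom_pos a \<le> 1" using geom_pos_bounds[of a] a by auto
  have oC: "geom_pos C < 1" using geom_pos_bounds[of C] C_pos by auto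
  have g: "0 < g" using sub by (simp add: g_def)
  have "geom_pos C - (geom_pos a)\<^sup>2 \<le> 1" using oC zero_le_power2[of "geom_pos a"] by linarith
  then have g1: "g \<le> 1" by (simp add: g_def)
  have den: "19 + 3 / d > 0" using d by (simp add: add_pos_pos)
  have \<epsilon>: "\<epsilon> > 0" using g den by (simp add: \<epsilon>_def)
  have "\<epsilon> * (19 + 3 / d) \<le> g / (19 + 3 / d) * (19 + 3 / d)"
    using den by (intro mult_right_mono) (auto simp: \<epsilon>_def)
  also have "\<dots> = g" using den by simp
  finally have \<epsilon>g: "19 * \<epsilon> + 3 * \<epsilon> / d \<le> g" by (simp add: algebra_simps)
  have \<epsilon>1: "\<epsilon> \<le> 1" by (simp add: \<epsilon>_def)
  have "\<epsilon> / 2 > 0" using \<epsilon> by simp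
  have ev: "eventually (\<lambda>n. \<forall>X\<in>samples n. \<not> bad \<epsilon> n X \<longrightarrow> real (mixed_total n X) \<le> a * (real (m n) * real n)
       \<longrightarrow> up_rate n X \<le> down_rate n X - g) sequentially"
    using eventually_loss_le[OF \<epsilon>] eventually_m_over_n_le[OF \<open>\<epsilon> / 2 > 0\<close>] eventually_loss_le[OF d] eventually_ge_at_top[of 1]
  proof eventually_elim
    case (elim n)
    show ?case
    proof (intro ballI impI)
      fix X assume X: "X \<in> samples n" and good: "\<not> bad \<epsilon> n X" and Wa: "real (mixed_total n X) \<le> a * (real (m n) * real n)"
      note dens = good_densities[OF X elim(4) \<epsilon> good]
      have n: "real n > 0" and m: "real (m n) > 0" using elim m_bounds(3)[of n] by auto
      have c: "card (special n) \<ge> 1" "card (ordinary n) \<ge> 1" using m n by (auto simp: block_sets)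
      define u where "u = real (mixed_total n X) / (real (m n) * real n)"
      have u: "0 \<le> u" "u \<le> a" using Wa m n by (auto simp: u_def divide_le_eq)
      then have ou: "geom_pos u \<le> geom_pos a" by (intro geom_pos_mono) auto
      let ?ss = "pos_density (special n) (special n) X" and ?oo = "pos_density (ordinary n) (ordinary n) X"
        and ?so = "pos_density (special n) (ordinary n) X" and ?os = "pos_density (ordinary n) (special n) X"
      have "1 / real n \<le> loss n" using B_pos C_pos by (simp add: loss_def)
      then have "1 / real n \<le> d" using elim(3) by linarith
      then have dn: "1 \<le> d * real n" using n by (simp add: field_simps)
      have T: "real (m n) * (d * real n) \<le> real (special_total n X)"
      proof -
        have "real (special_total n X) = real (m n) * real (R n) - real (mixed_total n X)"
          using block_totals(1)[OF X] by (simp flip: of_nat_mult add: of_nat_diff algebra_simps)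
        also have "\<dots> \<ge> real (m n) * (B * C * real n - 1) - a * (real (m n) * real n)"
          using R_bounds(2)[of n] Wa by (intro diff_mono mult_left_mono) auto
        also have "real (m n) * (B * C * real n - 1) - a * (real (m n) * real n) = real (m n) * (2 * (d * real n) - 1)"
          by (simp add: d_def algebra_simps)
        also have "real (m n) * (2 * (d * real n) - 1) \<ge> real (m n) * (d * real n)"
          using dn by (intro mult_left_mono) auto
        finally show ?thesis .
      qed
      have "(1 - ?ss) * (real (m n) * (d * real n)) \<le> (1 - ?ss) * real (special_total n X)"
        using T pos_density_bounds(2)[OF c(1) c(1), of X] by (intro mult_left_mono) auto
      also note dens(4)
      finally have "(1 - ?ss) * (d * real n) * real (m n) \<le> (2 * real (m n) + 2 * \<epsilon> * real n) * real (m n)"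
        by (simp add: mult_ac)
      then have "(1 - ?ss) * (d * real n) \<le> 2 * real (m n) + 2 * \<epsilon> * real n"
        using m by (rule mult_right_le_imp_le)
      also have "\<dots> \<le> 3 * \<epsilon> * real n" using elim(2) n by (simp add: field_simps)
      finally have "(1 - ?ss) * d * real n \<le> 3 * \<epsilon> * real n" by (simp add: mult_ac)
      then have "(1 - ?ss) * d \<le> 3 * \<epsilon>" using n by (rule mult_right_le_imp_le)
      then have ss: "1 - ?ss \<le> 3 * \<epsilon> / d" using d by (simp add: field_simps)
      have oo: "geom_pos C - 4 * \<epsilon> \<le> ?oo" "?oo \<le> 1"
        using dens(1) elim(1) pos_density_bounds(2)[OF c(2) c(2), of X] by linarith+
      have "(1 - ?ss) * ?oo \<le> (1 - ?ss) * 1"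
        using oo(2) pos_density_bounds(2)[OF c(1) c(1), of X] by (intro mult_left_mono) auto
      then have down: "geom_pos C - 4 * \<epsilon> - 3 * \<epsilon> / d \<le> down_rate n X"
        using ss oo(1) by (simp add: down_rate_def algebra_simps)
      have "?so \<le> geom_pos a + 3 * \<epsilon>" "?os \<le> geom_pos a + 3 * \<epsilon>"
        using dens(2,3) elim(1) ou unfolding u_def by linarith+
      then have "up_rate n X \<le> (geom_pos a + 3 * \<epsilon>) * (geom_pos a + 3 * \<epsilon>)"
        unfolding up_rate_def
        using pos_density_bounds(1)[OF c(1) c(2), of X] pos_density_bounds(1)[OF c(2) c(1), of X] oa \<epsilon>
        by (intro mult_mono) auto
      also have "\<dots> = (geom_pos a)\<^sup>2 + 6 * (\<epsilon> * geom_pos a) + 9 * (\<epsilon> * \<epsilon>)" by (simp add: algebra_simps power2_eq_square)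
      also have "\<dots> \<le> (geom_pos a)\<^sup>2 + 6 * (\<epsilon> * 1) + 9 * (\<epsilon> * 1)"
        using oa \<epsilon> \<epsilon>1 by (intro add_mono mult_left_mono) auto
      finally have "up_rate n X \<le> (geom_pos a)\<^sup>2 + 15 * \<epsilon>" by simp
      with down \<epsilon>g g2 show "up_rate n X \<le> down_rate n X - g" by linarith
    qed
  qed
  show thesis by (rule that[OF \<epsilon> g g1 ev])
qed

text \<open>The rate down is at most the density of the ordinary block, which is near \<open>geom_pos C\<close>, and the rate up is at
  least about \<open>(geom_pos a)\<^sup>2\<close>.\<close>

lemma mixed_total_drift:
  assumes a: "0 \<le> a" and super: "geom_pos C < (geom_pos a)\<^sup>2"
  obtains \<epsilon> g where "\<epsilon> > 0" "0 < g" "g \<le> 1"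
    "eventually (\<lambda>n. \<forall>X\<in>samples n. \<not> bad \<epsilon> n X \<longrightarrow> a * (real (m n) * real n) \<le> real (mixed_total n X)
       \<longrightarrow> down_rate n X \<le> up_rate n X - g) sequentially"
proof -
  define g where "g = ((geom_pos a)\<^sup>2 - geom_pos C) / 2"
  have g2: "2 * g = (geom_pos a)\<^sup>2 - geom_pos C" by (simp add: g_def)
  \<comment> \<open>the two rates lose at most \<open>6 * \<epsilon>\<close> and \<open>4 * \<epsilon>\<close>\<close>
  define \<epsilon> where "\<epsilon> = g / 10"
  have oa: "0 \<le> geom_pos a" "geom_pos a \<le> 1" using geom_pos_bounds[of a] a by auto
  have oC: "0 \<le> geom_pos C" using geom_pos_bounds[of C] C_pos by auto
  have oa2: "(geom_pos a)\<^sup>2 \<le> geom_pos a" using oa by (simp add: power2_eq_square mult_left_le)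
  have g: "0 < g" using super by (simp add: g_def)
  have "(geom_pos a)\<^sup>2 - geom_pos C \<le> 1" using oC oa oa2 by linarith
  then have g1: "g \<le> 1" by (simp add: g_def)
  have \<epsilon>: "\<epsilon> > 0" using g by (simp add: \<epsilon>_def)
  have \<epsilon>a: "3 * \<epsilon> \<le> geom_pos a" using oC oa oa2 g g2 unfolding \<epsilon>_def by linarith
  have ev: "eventually (\<lambda>n. \<forall>X\<in>samples n. \<not> bad \<epsilon> n X \<longrightarrow> a * (real (m n) * real n) \<le> real (mixed_total n X)
       \<longrightarrow> down_rate n X \<le> up_rate n X - g) sequentially"
    using eventually_loss_le[OF \<epsilon>] eventually_ge_at_top[of 1]
  proof eventually_elim
    case (elim n)
    show ?case
    proof (intro ballI impI)
      fix X assume X: "X \<in> samples n" and good: "\<not> bad \<epsilon> n X" and Wa: "a * (real (m n) * real n) \<le> real (mixed_total n X)"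
      note dens = good_densities[OF X elim(2) \<epsilon> good]
      have n: "real n > 0" and m: "real (m n) > 0" using elim m_bounds(3)[of n] by auto
      have c: "card (special n) \<ge> 1" "card (ordinary n) \<ge> 1" using m n by (auto simp: block_sets)
      define u where "u = real (mixed_total n X) / (real (m n) * real n)"
      have u: "a \<le> u" using Wa m n by (auto simp: u_def le_divide_eq)
      then have ou: "geom_pos a \<le> geom_pos u" using a by (intro geom_pos_mono) auto
      let ?ss = "pos_density (special n) (special n) X" and ?oo = "pos_density (ordinary n) (ordinary n) X"
        and ?so = "pos_density (special n) (ordinary n) X" and ?os = "pos_density (ordinary n) (special n) X"
      have "down_rate n X \<le> 1 * ?oo"
        unfolding down_rate_def
        using pos_density_bounds[OF c(1) c(1), of X] pos_density_bounds[OF c(2) c(2), of X]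
        by (intro mult_right_mono) auto
      then have down: "down_rate n X \<le> geom_pos C + 4 * \<epsilon>" using dens(1) elim(1) by linarith
      have "geom_pos a - 3 * \<epsilon> \<le> ?so" "geom_pos a - 3 * \<epsilon> \<le> ?os"
        using dens(2,3) elim(1) ou unfolding u_def by linarith+
      then have "(geom_pos a - 3 * \<epsilon>) * (geom_pos a - 3 * \<epsilon>) \<le> up_rate n X"
        unfolding up_rate_def using \<epsilon>a by (intro mult_mono) auto
      moreover have "(geom_pos a - 3 * \<epsilon>) * (geom_pos a - 3 * \<epsilon>) = (geom_pos a)\<^sup>2 - 6 * (\<epsilon> * geom_pos a) + 9 * (\<epsilon> * \<epsilon>)"
        by (simp add: algebra_simps power2_eq_square)
      moreover have "\<epsilon> * geom_pos a \<le> \<epsilon> * 1" "0 \<le> \<epsilon> * \<epsilon>" using oa \<epsilon> by (auto intro: mult_left_mono)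
      ultimately have "(geom_pos a)\<^sup>2 - 6 * \<epsilon> \<le> up_rate n X" by linarith
      with down g2 show "down_rate n X \<le> up_rate n X - g" unfolding \<epsilon>_def by linarith
    qed
  qed
  show thesis by (rule that[OF \<epsilon> g g1 ev])
qed

text \<open>The distance \<open>n\<close> to the threshold makes the geometric factor summable, and it is negligible compared with
  the scale \<open>m n * n\<close> of the totals.\<close>

lemma drift_rare:
  fixes F G :: "nat \<Rightarrow> (nat \<Rightarrow> nat \<Rightarrow> nat) \<Rightarrow> real" and Z :: "nat \<Rightarrow> (nat \<Rightarrow> nat \<Rightarrow> nat) \<Rightarrow> nat" and \<tau> :: "nat \<Rightarrow> nat"
  assumes bounds: "\<And>n X. n \<ge> 1 \<Longrightarrow> 0 \<le> F n X" "\<And>n X. n \<ge> 1 \<Longrightarrow> F n X \<le> 1" "\<And>n X. n \<ge> 1 \<Longrightarrow> G n X \<le> 1"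
    and bal: "\<And>n (h :: nat \<Rightarrow> real). (\<Sum>X\<in>samples n. F n X * h (Z n X)) = (\<Sum>X\<in>samples n. G n X * h (Z n X + 1))"
    and g: "0 < g" "g \<le> 1"
    and bad: "rare Q"
    and drift: "eventually (\<lambda>n. \<forall>X\<in>samples n. \<not> Q n X \<longrightarrow> \<tau> n \<le> Z n X \<longrightarrow> G n X \<le> F n X - g) sequentially"
  shows "rare (\<lambda>n X. \<tau> n + n \<le> Z n X)"
  unfolding rare_def
proof (rule summable_comparison_test_ev)
  show "summable (\<lambda>n. ((1 - g) ^ n + 2 * sample_prob n (Q n)) / g)"
    using bad g by (intro summable_divide summable_add summable_mult summable_geometric) (auto simp: rare_def)
  show "eventually (\<lambda>n. norm (sample_prob n (\<lambda>X. \<tau> n + n \<le> Z n X)) \<le> ((1 - g) ^ n + 2 * sample_prob n (Q n)) / g) sequentially"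
    using drift eventually_ge_at_top[of 1]
  proof eventually_elim
    case (elim n)
    have pos: "real (card (samples n)) > 0" unfolding samples_def using card_tables_pos by simp
    have eq: "sample_prob n Q' = card {X \<in> samples n. Q' X} / card (samples n)" for Q'
      by (simp add: sample_prob_def samples_def table_prob_eq_card)
    have "g * card {X \<in> samples n. \<tau> n + n \<le> Z n X} \<le> (1 - g) ^ n * card (samples n) + 2 * real (card {X \<in> samples n. Q n X})"
      by (rule drift_tail[where F = "F n" and G = "G n"])
        (use bounds[OF elim(2)] bal g elim(1) in \<open>auto simp: samples_def finite_tables\<close>)
    then have "g * sample_prob n (\<lambda>X. \<tau> n + n \<le> Z n X) \<le> (1 - g) ^ n + 2 * sample_prob n (Q n)"
      unfolding eq using pos by (simp add: field_simps)
    then show ?case using g by (simp add: sample_prob_nonneg field_simps)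
  qed
qed

lemma eventually_m_ge: "\<delta> > 0 \<Longrightarrow> eventually (\<lambda>n. M \<le> real (m n)) sequentially"
  using m_at_top unfolding filterlim_at_top by blast

lemma mixed_total_not_small:
  assumes "\<delta> > 0" "b < min (B * C) (critical_B C * C)"
  shows "rare (\<lambda>n X. real (mixed_total n X) \<le> b * (real (m n) * real n))"
proof -
  define u where "u = min (B * C) (critical_B C * C)"
  \<comment> \<open>a threshold strictly between \<open>b\<close> and the limit, so that the distance from \<open>b\<close> leaves room for \<open>n\<close> steps of drift\<close>
  define a where "a = (max b 0 + u) / 2"
  have "u > 0" using B_pos C_pos geom_pos_critical(2)[OF C_pos] by (simp add: u_def)
  then have a: "0 \<le> a" "b < a" "a < u" using assms(2) by (auto simp: a_def u_def[symmetric])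
  have aBC: "a < B * C" "a < critical_B C * C" using a(3) by (auto simp: u_def)
  have "geom_pos a < geom_pos (critical_B C * C)" using a aBC by (intro geom_pos_strict_mono) auto
  then have "(geom_pos a)\<^sup>2 < (geom_pos (critical_B C * C))\<^sup>2"
    using geom_pos_bounds(1)[OF a(1)] by (intro power_strict_mono) auto
  then have sub: "(geom_pos a)\<^sup>2 < geom_pos C" using geom_pos_critical(1)[OF C_pos] by simp
  obtain \<epsilon> g where eg: "\<epsilon> > 0" "0 < g" "g \<le> 1" and
    drift: "eventually (\<lambda>n. \<forall>X\<in>samples n. \<not> bad \<epsilon> n X \<longrightarrow> real (mixed_total n X) \<le> a * (real (m n) * real n)
       \<longrightarrow> up_rate n X \<le> down_rate n X - g) sequentially"
    by (rule special_total_drift[OF a(1) aBC(1) sub])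
  have TW: "real (special_total n X) = real (m n) * real (R n) - real (mixed_total n X)" if "X \<in> samples n" for n X
    using block_totals(1)[OF that] by (simp flip: of_nat_mult add: of_nat_diff algebra_simps)
  define \<tau> where "\<tau> n = nat \<lceil>real (m n) * real (R n) - a * (real (m n) * real n)\<rceil>" for n
  have "rare (\<lambda>n X. \<tau> n + n \<le> special_total n X)"
  proof (rule drift_rare[where F = down_rate and G = up_rate and Z = special_total and Q = "bad \<epsilon>" and g = g,
      OF rate_bounds(1,2,4) special_total_balance eg(2,3) bad_rare[OF eg(1) assms(1)]])
    show "eventually (\<lambda>n. \<forall>X\<in>samples n. \<not> bad \<epsilon> n X \<longrightarrow> \<tau> n \<le> special_total n X \<longrightarrow> up_rate n X \<le> down_rate n X - g) sequentially"
      using drift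
    proof eventually_elim
      case (elim n)
      show ?case
      proof (intro ballI impI)
        fix X assume X: "X \<in> samples n" "\<not> bad \<epsilon> n X" "\<tau> n \<le> special_total n X"
        have "real (m n) * real (R n) - a * (real (m n) * real n) \<le> real (special_total n X)"
          using X(3) unfolding \<tau>_def by linarith
        then have "real (mixed_total n X) \<le> a * (real (m n) * real n)" using TW[OF X(1)] by linarith
        with elim X show "up_rate n X \<le> down_rate n X - g" by blast
      qed
    qed
  qed
  then show ?thesis
  proof (rule rare_mono)
    have large: "eventually (\<lambda>n. 2 / (a - b) \<le> real (m n)) sequentially" by (rule eventually_m_ge[OF assms(1)])
    have "B * C - a > 0" using aBC by simp
    from eventually_loss_le[OF this] large eventually_ge_at_top[of 1]
    show "eventually (\<lambda>n. \<forall>X\<in>samples n. real (mixed_total n X) \<le> b * (real (m n) * real n) \<longrightarrow> \<tau> n + n \<le> special_total n X) sequentially"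
    proof eventually_elim
      case (elim n)
      have n: "real n \<ge> 1" using elim by simp
      have "1 / real n \<le> loss n" using B_pos C_pos by (simp add: loss_def)
      then have "1 / real n \<le> B * C - a" using elim(1) by linarith
      then have "1 \<le> (B * C - a) * real n" using n by (simp add: divide_le_eq)
      then have "a * real n \<le> real (R n)" using R_bounds(2)[of n] by (simp add: algebra_simps)
      then have "real (m n) * (a * real n) \<le> real (m n) * real (R n)" by (rule mult_left_mono) simp
      then have "real (\<tau> n) \<le> real (m n) * real (R n) - a * (real (m n) * real n) + 1"
        unfolding \<tau>_def by (simp add: mult_ac)
      moreover have "2 \<le> (a - b) * real (m n)" using elim(2) a(2) by (simp add: field_simps)
      then have "2 * real n \<le> (a - b) * real (m n) * real n" by (rule mult_right_mono) simp
      ultimately have *: "real (\<tau> n + n) \<le> real (m n) * real (R n) - b * (real (m n) * real n)"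
        using n by (simp add: algebra_simps)
      show ?case
      proof (intro ballI impI)
        fix X assume "X \<in> samples n" "real (mixed_total n X) \<le> b * (real (m n) * real n)"
        then have "real (\<tau> n + n) \<le> real (special_total n X)" using TW * by force
        then show "\<tau> n + n \<le> special_total n X" by (simp only: of_nat_le_iff)
      qed
    qed
  qed
qed

text \<open>Either \<open>b\<close> exceeds what the margin of the special rows allows, or it is supercritical and the drift applies.\<close>

lemma mixed_total_not_large:
  assumes "\<delta> > 0" "b > min (B * C) (critical_B C * C)"
  shows "rare (\<lambda>n X. b * (real (m n) * real n) \<le> real (mixed_total n X))"
proof (cases "b > B * C")
  case True
  show ?thesis
  proof (rule rareI_inverse_square[where A = 0])
    show "eventually (\<lambda>n. sample_prob n (\<lambda>X. b * (real (m n) * real n) \<le> real (mixed_total n X)) \<le> 0 / (real n)\<^sup>2) sequentially"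
      using eventually_ge_at_top[of 1]
    proof eventually_elim
      case (elim n)
      have "\<not> b * (real (m n) * real n) \<le> real (mixed_total n X)" if "X \<in> samples n" for X
      proof -
        have "real (mixed_total n X) \<le> real (m n * R n)" using block_totals(1)[OF that] by linarith
        also have "\<dots> \<le> real (m n) * (B * C * real n)"
          using R_bounds(1)[of n] by (simp add: mult_left_mono)
        also have "\<dots> < b * (real (m n) * real n)"
          using True elim m_bounds(3)[OF elim] by simp
        finally show ?thesis by simp
      qed
      then show ?case by (simp add: sample_prob_def table_prob_eq_card samples_def cong: conj_cong)
    qed
  qed
next
  case False
  define u where "u = critical_B C * C"
  define a where "a = (b + u) / 2"
  have u: "u > 0" using geom_pos_critical(2)[OF C_pos] by (simp add: u_def)
  have ub: "u < b" using False assms(2) by (auto simp: u_def min_def split: if_splits)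
  have a: "0 \<le> a" "u < a" "a < b" using u ub by (auto simp: a_def)
  have "geom_pos u < geom_pos a" using a u by (intro geom_pos_strict_mono) auto
  then have "(geom_pos u)\<^sup>2 < (geom_pos a)\<^sup>2"
    using geom_pos_bounds(1)[of u] u by (intro power_strict_mono) auto
  then have super: "geom_pos C < (geom_pos a)\<^sup>2" using geom_pos_critical(1)[OF C_pos] by (simp add: u_def)
  obtain \<epsilon> g where eg: "\<epsilon> > 0" "0 < g" "g \<le> 1" and
    drift: "eventually (\<lambda>n. \<forall>X\<in>samples n. \<not> bad \<epsilon> n X \<longrightarrow> a * (real (m n) * real n) \<le> real (mixed_total n X)
       \<longrightarrow> down_rate n X \<le> up_rate n X - g) sequentially"
    by (rule mixed_total_drift[OF a(1) super])
  define \<tau> where "\<tau> n = nat \<lceil>a * (real (m n) * real n)\<rceil>" for n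
  have "rare (\<lambda>n X. \<tau> n + n \<le> mixed_total n X)"
  proof (rule drift_rare[where F = up_rate and G = down_rate and Z = mixed_total and Q = "bad \<epsilon>" and g = g,
      OF rate_bounds(3,4,2) mixed_total_balance eg(2,3) bad_rare[OF eg(1) assms(1)]])
    show "eventually (\<lambda>n. \<forall>X\<in>samples n. \<not> bad \<epsilon> n X \<longrightarrow> \<tau> n \<le> mixed_total n X \<longrightarrow> down_rate n X \<le> up_rate n X - g) sequentially"
      using drift
    proof eventually_elim
      case (elim n)
      show ?case
      proof (intro ballI impI)
        fix X assume X: "X \<in> samples n" "\<not> bad \<epsilon> n X" "\<tau> n \<le> mixed_total n X"
        have "a * (real (m n) * real n) \<le> real (mixed_total n X)"
          using X(3) unfolding \<tau>_def by linarith
        with elim X show "down_rate n X \<le> up_rate n X - g" by blast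
      qed
    qed
  qed
  then show ?thesis
  proof (rule rare_mono)
    have large: "eventually (\<lambda>n. 2 / (b - a) \<le> real (m n)) sequentially" by (rule eventually_m_ge[OF assms(1)])
    from large eventually_ge_at_top[of 1]
    show "eventually (\<lambda>n. \<forall>X\<in>samples n. b * (real (m n) * real n) \<le> real (mixed_total n X) \<longrightarrow> \<tau> n + n \<le> mixed_total n X) sequentially"
    proof eventually_elim
      case (elim n)
      have n: "real n \<ge> 1" using elim by simp
      have "0 \<le> a * (real (m n) * real n)" using a by simp
      then have "real (\<tau> n) \<le> a * (real (m n) * real n) + 1"
        unfolding \<tau>_def by linarith
      moreover have "2 \<le> (b - a) * real (m n)" using elim(1) a(3) by (simp add: field_simps)
      then have "2 * real n \<le> (b - a) * real (m n) * real n" by (rule mult_right_mono) simp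
      ultimately have *: "real (\<tau> n + n) \<le> b * (real (m n) * real n)"
        using n by (simp add: algebra_simps)
      show ?case
      proof (intro ballI impI)
        fix X assume "b * (real (m n) * real n) \<le> real (mixed_total n X)"
        with * have "real (\<tau> n + n) \<le> real (mixed_total n X)" by linarith
        then show "\<tau> n + n \<le> mixed_total n X" by (simp only: of_nat_le_iff)
      qed
    qed
  qed
qed

section \<open>Single rows\<close>

text \<open>All special rows agree on the ordinary columns, so each is near the average \<open>mixed_total n X / m n\<close>.\<close>

lemma special_row_concentrates:
  assumes "\<delta> > 0" "\<epsilon> > 0"
  shows "rare (\<lambda>n X. \<epsilon> \<le> \<bar>real (\<Sum>j\<in>ordinary n. X 0 j) / real n - min (B * C) (critical_B C * C)\<bar>)"
proof -
  define u where "u = min (B * C) (critical_B C * C)"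
  let ?N = "\<lambda>n. real (m n) * real n"
  have e: "\<epsilon> / 2 > 0" using assms by simp
  have "rare (\<lambda>n X. disagree difference (\<epsilon> / 2 * real n) (special n) (ordinary n) X \<or>
    real (mixed_total n X) \<le> (u - \<epsilon> / 2) * ?N n \<or> (u + \<epsilon> / 2) * ?N n \<le> real (mixed_total n X))"
    by (intro rare_disj special_ordinary_row_sums_agree mixed_total_not_small mixed_total_not_large) (use assms e in \<open>auto simp: u_def\<close>)
  then have "rare (\<lambda>n X. \<epsilon> \<le> \<bar>real (\<Sum>j\<in>ordinary n. X 0 j) / real n - u\<bar>)"
  proof (rule rare_mono)
    show "eventually (\<lambda>n. \<forall>X\<in>samples n. \<epsilon> \<le> \<bar>real (\<Sum>j\<in>ordinary n. X 0 j) / real n - u\<bar> \<longrightarrow>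
      disagree difference (\<epsilon> / 2 * real n) (special n) (ordinary n) X \<or>
      real (mixed_total n X) \<le> (u - \<epsilon> / 2) * ?N n \<or> (u + \<epsilon> / 2) * ?N n \<le> real (mixed_total n X)) sequentially"
      using eventually_ge_at_top[of 1]
    proof eventually_elim
      case (elim n)
      have n: "real n > 0" and m: "real (m n) > 0" using elim m_bounds(3)[of n] by auto
      show ?case
      proof (intro ballI impI, rule ccontr)
        fix X assume far: "\<epsilon> \<le> \<bar>real (\<Sum>j\<in>ordinary n. X 0 j) / real n - u\<bar>"
          and "\<not> (disagree difference (\<epsilon> / 2 * real n) (special n) (ordinary n) X \<or>
            real (mixed_total n X) \<le> (u - \<epsilon> / 2) * ?N n \<or> (u + \<epsilon> / 2) * ?N n \<le> real (mixed_total n X))"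
        then have agree: "\<not> disagree difference (\<epsilon> / 2 * real n) (special n) (ordinary n) X"
          and W: "(u - \<epsilon> / 2) * ?N n < real (mixed_total n X)" "real (mixed_total n X) < (u + \<epsilon> / 2) * ?N n" by auto
        have "\<bar>real (\<Sum>j\<in>ordinary n. X 0 j) - (\<Sum>k\<in>special n. real (\<Sum>j\<in>ordinary n. X k j)) / real (card (special n))\<bar> \<le> \<epsilon> / 2 * real n"
          by (rule near_mean)
            (use not_disagreeD[OF agree] m n e in \<open>auto simp: block_sets special_def sum_subtractf\<close>)
        then have "\<bar>real (\<Sum>j\<in>ordinary n. X 0 j) - real (mixed_total n X) / real (m n)\<bar> \<le> \<epsilon> / 2 * real n"
          by (simp add: block_sets mixed_total_def block_sum_def)
        moreover have "(u - \<epsilon> / 2) * real n < real (mixed_total n X) / real (m n)" "real (mixed_total n X) / real (m n) < (u + \<epsilon> / 2) * real n"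
          using W m by (auto simp: field_simps)
        ultimately have "\<bar>real (\<Sum>j\<in>ordinary n. X 0 j) - u * real n\<bar> < \<epsilon> * real n"
          unfolding left_diff_distrib distrib_right by linarith
        also have "real (\<Sum>j\<in>ordinary n. X 0 j) - u * real n = (real (\<Sum>j\<in>ordinary n. X 0 j) / real n - u) * real n"
          using n by (simp add: field_simps)
        finally have "\<bar>real (\<Sum>j\<in>ordinary n. X 0 j) / real n - u\<bar> * real n < \<epsilon> * real n"
          using n by (simp add: abs_mult)
        then have "\<bar>real (\<Sum>j\<in>ordinary n. X 0 j) / real n - u\<bar> < \<epsilon>" using n by simp
        with far show False by simp
      qed
    qed
  qed
  then show ?thesis by (simp add: u_def)
qed

text \<open>All ordinary rows agree on the ordinary columns, and their average there is near \<open>C * n\<close> because the special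
  columns hold a negligible part of the total mass.\<close>

lemma ordinary_row_concentrates:
  assumes "\<epsilon> > 0"
  shows "rare (\<lambda>n X. \<epsilon> \<le> \<bar>real (\<Sum>j\<in>ordinary n. X n j) / real n - C\<bar>)"
proof -
  have e: "\<epsilon> / 4 > 0" using assms by simp
  have "rare (\<lambda>n X. disagree difference (\<epsilon> / 4 * real n) (ordinary n) (ordinary n) X)"
    by (rule ordinary_ordinary_row_sums_agree[OF e])
  then show ?thesis
  proof (rule rare_mono)
    show "eventually (\<lambda>n. \<forall>X\<in>samples n. \<epsilon> \<le> \<bar>real (\<Sum>j\<in>ordinary n. X n j) / real n - C\<bar> \<longrightarrow>
      disagree difference (\<epsilon> / 4 * real n) (ordinary n) (ordinary n) X) sequentially"
      using eventually_ge_at_top[of 1] eventually_loss_le[OF e]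
    proof eventually_elim
      case (elim n)
      have n: "real n > 0" using elim by auto
      have row: "n \<in> ordinary n" using m_bounds[OF elim(1)] by (simp add: ordinary_def)
      show ?case
      proof (intro ballI impI, rule ccontr)
        fix X assume X: "X \<in> samples n" and far: "\<epsilon> \<le> \<bar>real (\<Sum>j\<in>ordinary n. X n j) / real n - C\<bar>"
          and agree: "\<not> disagree difference (\<epsilon> / 4 * real n) (ordinary n) (ordinary n) X"
        define w where "w = real (block_sum X (ordinary n) (ordinary n)) / (real n * real n)"
        have "\<bar>real (\<Sum>j\<in>ordinary n. X n j) - (\<Sum>k\<in>ordinary n. real (\<Sum>j\<in>ordinary n. X k j)) / real (card (ordinary n))\<bar> \<le> \<epsilon> / 4 * real n"
          by (rule near_mean)
            (use not_disagreeD[OF agree] row n e in \<open>auto simp: block_sets sum_subtractf\<close>)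
        then have "\<bar>real (\<Sum>j\<in>ordinary n. X n j) - w * real n\<bar> \<le> \<epsilon> / 4 * real n"
          using n by (simp add: block_sets w_def block_sum_def)
        also have "real (\<Sum>j\<in>ordinary n. X n j) - w * real n = (real (\<Sum>j\<in>ordinary n. X n j) / real n - w) * real n"
          using n by (simp add: field_simps)
        finally have "\<bar>real (\<Sum>j\<in>ordinary n. X n j) / real n - w\<bar> * real n \<le> \<epsilon> / 4 * real n"
          using n by (simp add: abs_mult)
        then have "\<bar>real (\<Sum>j\<in>ordinary n. X n j) / real n - w\<bar> \<le> \<epsilon> / 4" using n by simp
        moreover have "\<bar>w - C\<bar> \<le> \<epsilon> / 4"
          using ordinary_block_mean[OF X elim(1)] elim(2) unfolding w_def by linarith
        ultimately show False using far e by linarith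
      qed
    qed
  qed
qed

end

section \<open>Almost sure convergence\<close>

definition entry_fun :: "nat \<Rightarrow> nat mat \<Rightarrow> nat \<Rightarrow> nat \<Rightarrow> nat" where
  "entry_fun N A i j = (if i < N \<and> j < N then A $$ (i, j) else 0)"

lemma (in phase_parameters) entry_fun_bij:
  "bij_betw (entry_fun (m n + n)) (contingency_tables n \<delta> B C) (samples n)"
proof (rule bij_betw_byWitness[where f' = "\<lambda>X. mat (m n + n) (m n + n) (\<lambda>(i, j). X i j)"])
  show "entry_fun (m n + n) ` contingency_tables n \<delta> B C \<subseteq> samples n"
    by (auto simp: entry_fun_def contingency_tables_def samples_def tables_def m_def)
  show "(\<lambda>X. mat (m n + n) (m n + n) (\<lambda>(i, j). X i j)) ` samples n \<subseteq> contingency_tables n \<delta> B C"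
    by (auto simp: contingency_tables_def samples_def tables_def m_def)
  show "\<forall>A\<in>contingency_tables n \<delta> B C. mat (m n + n) (m n + n) (\<lambda>(i, j). entry_fun (m n + n) A i j) = A"
    by (auto simp: entry_fun_def contingency_tables_def m_def intro!: eq_matI)
  show "\<forall>X\<in>samples n. entry_fun (m n + n) (mat (m n + n) (m n + n) (\<lambda>(i, j). X i j)) = X"
    by (auto simp: entry_fun_def samples_def tables_def fun_eq_iff)
qed

lemma (in phase_parameters) prob_contingency:
  "measure_pmf.prob (pmf_of_set (contingency_tables n \<delta> B C)) {A. Q (entry_fun (m n + n) A)} = sample_prob n Q"
proof -
  let ?CT = "contingency_tables n \<delta> B C"
  have fin: "finite (samples n)" "samples n \<noteq> {}" by (auto simp: samples_def finite_tables tables_nonempty)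
  then have fin': "finite ?CT" "?CT \<noteq> {}"
    using bij_betw_finite[OF entry_fun_bij] entry_fun_bij[of n] by (auto simp: bij_betw_def)
  have "pmf_of_set (samples n) = map_pmf (entry_fun (m n + n)) (pmf_of_set ?CT)"
    by (rule map_pmf_of_set_bij_betw[symmetric, OF entry_fun_bij fin'(2,1)])
  then show ?thesis by (simp add: sample_prob_def table_prob_def samples_def[symmetric] vimage_def)
qed

text \<open>The case distinction in the sum keeps the index \<open>0\<close> out: the law of the matrix of that index is
  unspecified, and its event may fail to be measurable.\<close>

lemma AE_tendsto_if_summable:
  fixes Y :: "nat \<Rightarrow> 'w \<Rightarrow> real"
  assumes "prob_space P"
    and meas: "\<And>n \<epsilon>. n \<ge> 1 \<Longrightarrow> {\<omega> \<in> space P. \<epsilon> \<le> \<bar>Y n \<omega> - c\<bar>} \<in> sets P"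
    and sum: "\<And>\<epsilon>. \<epsilon> > 0 \<Longrightarrow> summable (\<lambda>n. if n = 0 then 0 else measure P {\<omega> \<in> space P. \<epsilon> \<le> \<bar>Y n \<omega> - c\<bar>})"
  shows "AE \<omega> in P. (\<lambda>n. Y n \<omega>) \<longlonglongrightarrow> c"
proof -
  interpret prob_space P by fact
  have ev: "AE \<omega> in P. eventually (\<lambda>n. \<bar>Y n \<omega> - c\<bar> < \<epsilon>) sequentially" if "\<epsilon> > 0" for \<epsilon>
  proof -
    define A where "A n = (if n = 0 then {} else {\<omega> \<in> space P. \<epsilon> \<le> \<bar>Y n \<omega> - c\<bar>})" for n
    have "AE \<omega> in P. eventually (\<lambda>n. \<omega> \<in> space P - A n) sequentially"
    proof (rule borel_cantelli_AE1)
      show "A n \<in> sets P" for n using meas by (simp add: A_def)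
      show "emeasure P (A n) < \<infinity>" for n by (simp add: less_top[symmetric])
      have "measure P (A n) = (if n = 0 then 0 else measure P {\<omega> \<in> space P. \<epsilon> \<le> \<bar>Y n \<omega> - c\<bar>})" for n
        by (simp add: A_def)
      then show "summable (\<lambda>n. measure P (A n))" using sum[OF that] by presburger
    qed
    then show ?thesis
    proof eventually_elim
      case (elim \<omega>)
      then show ?case using eventually_ge_at_top[of 1]
        by eventually_elim (auto simp: A_def split: if_splits)
    qed
  qed
  have "AE \<omega> in P. \<forall>k. eventually (\<lambda>n. \<bar>Y n \<omega> - c\<bar> < 1 / real (Suc k)) sequentially"
    unfolding AE_all_countable by (intro allI ev) simp
  then show ?thesis
  proof eventually_elim
    case (elim \<omega>)
    show ?case
    proof (rule tendstoI)
      fix e :: real assume "e > 0"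
      then obtain k where k: "1 / real (Suc k) < e" using nat_approx_posE by blast
      from elim have "eventually (\<lambda>n. \<bar>Y n \<omega> - c\<bar> < 1 / real (Suc k)) sequentially" by blast
      then show "eventually (\<lambda>n. dist (Y n \<omega>) c < e) sequentially"
        by eventually_elim (use k in \<open>simp add: dist_real_def\<close>)
    qed
  qed
qed

text \<open>For \<open>row n = 0\<close> this is a special row, for \<open>row n = n\<close> the ordinary row of index \<open>n + 1\<close> when
  counting from one.\<close>

lemma (in phase_parameters) AE_row_average_tendsto:
  fixes P :: "'w measure" and X :: "nat \<Rightarrow> 'w \<Rightarrow> nat mat" and row :: "nat \<Rightarrow> nat"
  assumes P: "prob_space P"
    and X: "\<And>n. n \<ge> 1 \<Longrightarrow> X n \<in> measurable P (count_space UNIV)"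
    and law: "\<And>n. n \<ge> 1 \<Longrightarrow>
           distr P (count_space UNIV) (X n) = measure_pmf (pmf_of_set (contingency_tables n \<delta> B C))"
    and row: "\<And>n. n \<ge> 1 \<Longrightarrow> row n < m n + n"
    and conc: "\<And>\<epsilon>. \<epsilon> > 0 \<Longrightarrow> rare (\<lambda>n X. \<epsilon> \<le> \<bar>real (\<Sum>j\<in>ordinary n. X (row n) j) / real n - c\<bar>)"
  shows "AE \<omega> in P. (\<lambda>n. 1 / real n * (\<Sum>k<n. real (X n \<omega> $$ (row n, k + num_special n \<delta>)))) \<longlonglongrightarrow> c"
proof (rule AE_tendsto_if_summable[OF P])
  let ?Y = "\<lambda>n \<omega>. 1 / real n * (\<Sum>k<n. real (X n \<omega> $$ (row n, k + num_special n \<delta>)))"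
  define E where "E n \<epsilon> = {A. \<epsilon> \<le> \<bar>real (\<Sum>j\<in>ordinary n. entry_fun (m n + n) A (row n) j) / real n - c\<bar>}" for n \<epsilon>
  have ev: "{\<omega> \<in> space P. \<epsilon> \<le> \<bar>?Y n \<omega> - c\<bar>} = X n -` E n \<epsilon> \<inter> space P" if n: "n \<ge> 1" for n \<epsilon>
  proof -
    have "(\<Sum>k<n. real (A $$ (row n, k + num_special n \<delta>))) = real (\<Sum>j\<in>ordinary n. entry_fun (m n + n) A (row n) j)" for A
      unfolding of_nat_sum
      by (rule sum.reindex_bij_witness[where i = "\<lambda>j. j - m n" and j = "\<lambda>k. k + m n"])
        (use row[OF n] in \<open>auto simp: ordinary_def entry_fun_def m_def\<close>)
    then show ?thesis by (auto simp: E_def)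
  qed
  show "{\<omega> \<in> space P. \<epsilon> \<le> \<bar>?Y n \<omega> - c\<bar>} \<in> sets P" if "n \<ge> 1" for n \<epsilon>
    unfolding ev[OF that] by (rule measurable_sets[OF X[OF that]]) simp
  show "summable (\<lambda>n. if n = 0 then 0 else measure P {\<omega> \<in> space P. \<epsilon> \<le> \<bar>?Y n \<omega> - c\<bar>})" if "\<epsilon> > 0" for \<epsilon>
  proof (rule summable_comparison_test_ev)
    show "summable (\<lambda>n. sample_prob n (\<lambda>X. \<epsilon> \<le> \<bar>real (\<Sum>j\<in>ordinary n. X (row n) j) / real n - c\<bar>))"
      using conc[OF that] by (simp add: rare_def)
    show "eventually (\<lambda>n. norm (if n = 0 then 0 else measure P {\<omega> \<in> space P. \<epsilon> \<le> \<bar>?Y n \<omega> - c\<bar>})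
      \<le> sample_prob n (\<lambda>X. \<epsilon> \<le> \<bar>real (\<Sum>j\<in>ordinary n. X (row n) j) / real n - c\<bar>)) sequentially"
      using eventually_ge_at_top[of 1]
    proof eventually_elim
      case (elim n)
      have "measure P (X n -` E n \<epsilon> \<inter> space P) = measure (distr P (count_space UNIV) (X n)) (E n \<epsilon>)"
        by (rule measure_distr[symmetric, OF X[OF elim]]) simp
      also have "\<dots> = sample_prob n (\<lambda>X. \<epsilon> \<le> \<bar>real (\<Sum>j\<in>ordinary n. X (row n) j) / real n - c\<bar>)"
        unfolding law[OF elim] E_def by (rule prob_contingency)
      finally show ?case using elim by (simp only: ev[OF elim]) (simp add: sample_prob_nonneg)
    qed
  qed
qed

theorem theorem2p3:
  fixes P :: "'w measure" and X :: "nat \<Rightarrow> 'w \<Rightarrow> nat mat" and B C \<delta> :: real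
  assumes "B > 0" and "C > 0" and "0 \<le> \<delta>" and "\<delta> < 1"
    and "prob_space P"
    and "\<And>n. n \<ge> 1 \<Longrightarrow> X n \<in> measurable P (count_space UNIV)"
    and "\<And>n. n \<ge> 1 \<Longrightarrow>
           distr P (count_space UNIV) (X n) = measure_pmf (pmf_of_set (contingency_tables n \<delta> B C))"
  shows "(1 / 2 < \<delta> \<longrightarrow>
            (B < critical_B C \<longrightarrow>
               (AE \<omega> in P. (\<lambda>n. 1 / real n * (\<Sum>k<n. real (X n \<omega> $$ (0, k + num_special n \<delta>))))
                              \<longlonglongrightarrow> B * C)) \<and>
            (B > critical_B C \<longrightarrow>
               (AE \<omega> in P. (\<lambda>n. 1 / real n * (\<Sum>k<n. real (X n \<omega> $$ (0, k + num_special n \<delta>))))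
                              \<longlonglongrightarrow> critical_B C * C))) \<and>
         (AE \<omega> in P. (\<lambda>n. 1 / real n * (\<Sum>k<n. real (X n \<omega> $$ (n, k + num_special n \<delta>))))
                        \<longlonglongrightarrow> C)"
proof -
  interpret phase_parameters B C \<delta> by unfold_locales (use assms in auto)
  have special: "AE \<omega> in P. (\<lambda>n. 1 / real n * (\<Sum>k<n. real (X n \<omega> $$ (0, k + num_special n \<delta>))))
      \<longlonglongrightarrow> min (B * C) (critical_B C * C)" if "\<delta> > 0"
    using special_row_concentrates[OF that]
    by (intro AE_row_average_tendsto[where row = "\<lambda>_. 0"] assms) auto
  have row: "n < m n + n" if "n \<ge> 1" for n using m_bounds(3)[OF that] by simp
  have ordinary: "AE \<omega> in P. (\<lambda>n. 1 / real n * (\<Sum>k<n. real (X n \<omega> $$ (n, k + num_special n \<delta>))))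
      \<longlonglongrightarrow> C"
    by (intro AE_row_average_tendsto[where row = "\<lambda>n. n"] assms ordinary_row_concentrates row)
  show ?thesis
  proof (intro conjI impI ordinary)
    assume \<delta>: "1 / 2 < \<delta>"
    {
      assume "B < critical_B C"
      then have "min (B * C) (critical_B C * C) = B * C"
        using assms(2) by (intro min_absorb1) simp
      with special \<delta> show "AE \<omega> in P. (\<lambda>n. 1 / real n * (\<Sum>k<n. real (X n \<omega> $$ (0, k + num_special n \<delta>))))
          \<longlonglongrightarrow> B * C" by simp
    next
      assume "critical_B C < B"
      then have "min (B * C) (critical_B C * C) = critical_B C * C"
        using assms(2) by (intro min_absorb2) simp
      with special \<delta> show "AE \<omega> in P. (\<lambda>n. 1 / real n * (\<Sum>k<n. real (X n \<omega> $$ (0, k + num_special n \<delta>))))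
          \<longlonglongrightarrow> critical_B C * C" by simp
    }
  qed
qed

end
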